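(* Let $(V,h,\epsilon)$ be a $4$-dimensional oriented Euclidean vector space. Then, as endomorphisms of $\Lambda^2V^*$, $$\tfrac13\widehat{X\ast Y}=\tfrac12\left(\widehat X\circ\widehat Y+\widehat Y\circ\widehat X\right)-\tfrac13\operatorname{tr}(\widehat X\circ\widehat Y)\,P_{\pm}\quad\text{if }X,Y\in\mathcal{MC}_W^{\pm}(V^* ),$$ $$\widehat{X\ast Y}=0\quad\text{if }X\in\mathcal{MC}_W^{+}(V^* ),\ Y\in\mathcal{MC}_W^{-}(V^* ),$$ where $P_\pm\in\operatorname{End}(\Lambda^2V^* )$ are the orthogonal projections onto $\Lambda^2_\pm V^*$ and all traces are over $\Lambda^2V^*$. Consequently, $$\mathcal{MC}_W^{\pm}(V^* )\ast\mathcal{MC}_W^{\pm}(V^* )=\mathcal{MC}_W^{\pm}(V^* ),\qquad\mathcal{MC}_W^{+}(V^* )\ast\mathcal{MC}_W^{-}(V^* )=\{0\}.$$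
   Context: $V$ is a real vector space with positive definite symmetric bilinear form $h_{ij}$; indices are raised and lowered with $h$; brackets around indices denote complete antisymmetrization, normalized to be a projection. Inner products on tensor spaces are by complete contraction with $h$. $\mathcal{MC}(V^* )=\{Y_{ijkl}\in\otimes^4V^*: Y_{[ij]kl}=Y_{ijkl}=Y_{ij[kl]},\ Y_{[ijk]l}=0\}$; $\rho(Y)_{ij}=Y_{pij}{}^p$; $\mathcal{MC}_W(V^* )=\ker\rho$. For $X\in\mathcal{MC}(V^* )$, $\widehat X\in\operatorname{End}(\otimes^kV^* )$ is $\widehat X(\alpha)_{i_1\dots i_k}=\tfrac1k\sum_{r\ne s}X^{p}{}_{i_ri_s}{}^{q}\,\alpha_{i_1\dots p\dots q\dots i_k}$, the sum running over ordered pairs $(r,s)$ of distinct positions, with $p$ in position $r$ and $q$ in position $s$. It preserves $\Lambda^2V^*$, where $\widehat X(\alpha)_{ij}=-\tfrac12\alpha^{pq}X_{ijpq}$; in the claim $\widehat{\ \cdot\ }$ means this restriction to $\Lambda^2V^*$. The commutative multiplication on $\mathcal{MC}(V^* )$ is $X\ast Y:=\widehat X(Y)$ (with $\widehat X$ acting on $\otimes^4V^*$). For subspaces, $U_1\ast U_2$ is the linear span of products. $\epsilon_{ijkl}$ is the Euclidean volume form of the orientation. The Hodge star on $\Lambda^2V^*$ is $(\star\alpha)_{ij}=\tfrac12\epsilon_{ij}{}^{pq}\alpha_{pq}$, with $\pm1$-eigenspaces $\Lambda^2_\pm V^*$. On $\mathcal{MC}_W(V^* )$, $(\star X)_{ijkl}=\tfrac12\epsilon_{ij}{}^{ab}X_{abkl}$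 is an involution, and $\mathcal{MC}^\pm_W(V^* )=\{X\in\mathcal{MC}_W(V^* ):\star X=\pm X\}$. *)

theory Defs
  imports
    "HOL-Analysis.Analysis"
    "HOL-Combinatorics.Permutations"
    "HOL-Library.Function_Algebras"
begin

instantiation "fun" :: (type, real_vector) real_vector
begin

definition scaleR_fun :: "real \<Rightarrow> ('a \<Rightarrow> 'b) \<Rightarrow> 'a \<Rightarrow> 'b"
  where "scaleR_fun c f = (\<lambda>x. c *\<^sub>R f x)"

instance
  by standard (simp_all add: scaleR_fun_def plus_fun_def fun_eq_iff scaleR_add_right scaleR_add_left)

end

text \<open>
  \<open>V\<close> is a type of class \<^class>\<open>euclidean_space\<close> and \<open>h\<close> is its inner product. A covariant tensor
  of rank \<open>k\<close> is a function on lists of vectors that is multilinear on lists of length \<open>k\<close> and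
  vanishes on lists of any other length, so that tensors are equal iff the functions are.
  Indices are contracted with \<open>h\<close> by summing over the orthonormal basis \<^const>\<open>Basis\<close>.
\<close>

type_synonym 'a tensor = "'a list \<Rightarrow> real"

definition tensors :: "nat \<Rightarrow> 'a::euclidean_space tensor set"
  where "tensors k =
    {T. (\<forall>vs. length vs \<noteq> k \<longrightarrow> T vs = 0) \<and>
        (\<forall>vs i. length vs = k \<longrightarrow> i < k \<longrightarrow> linear (\<lambda>v. T (vs[i := v])))}"

definition tensor_inner :: "nat \<Rightarrow> 'a::euclidean_space tensor \<Rightarrow> 'a tensor \<Rightarrow> real"
  where "tensor_inner k S T = (\<Sum>bs \<in> {bs. length bs = k \<and> set bs \<subseteq> Basis}. S bs * T bs)"

definition antisym :: "nat set \<Rightarrow> 'a tensor \<Rightarrow> 'a tensor"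
  where "antisym I T = (\<lambda>vs. (1 / fact (card I)) *
    (\<Sum>\<pi> \<in> {\<pi>. \<pi> permutes I}. of_int (sign \<pi>) * T (permute_list \<pi> vs)))"

definition alt_tensors :: "nat \<Rightarrow> 'a::euclidean_space tensor set"
  where "alt_tensors k = {\<alpha> \<in> tensors k. antisym {..<k} \<alpha> = \<alpha>}"

definition MC :: "'a::euclidean_space tensor set"
  where "MC = {Y \<in> tensors 4. antisym {0, 1} Y = Y \<and> antisym {2, 3} Y = Y \<and> antisym {0, 1, 2} Y = 0}"

definition ricci :: "'a::euclidean_space tensor \<Rightarrow> 'a tensor"
  where "ricci Y = (\<lambda>vs. \<Sum>p\<in>Basis. Y (p # vs @ [p]))"

definition MCW :: "'a::euclidean_space tensor set"
  where "MCW = {Y \<in> MC. ricci Y = 0}"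

text \<open>The rank \<open>k\<close> of \<open>\<alpha>\<close> need not be an argument: it is the length of the list of vectors.\<close>

definition hat :: "'a::euclidean_space tensor \<Rightarrow> 'a tensor \<Rightarrow> 'a tensor"
  where "hat X \<alpha> = (\<lambda>vs. (1 / real (length vs)) *
    (\<Sum>(r, s) \<in> {(r, s). r < length vs \<and> s < length vs \<and> r \<noteq> s}.
      \<Sum>p\<in>Basis. \<Sum>q\<in>Basis. X [p, vs ! r, vs ! s, q] * \<alpha> (vs[r := p, s := q])))"

definition mc_mult :: "'a::euclidean_space tensor \<Rightarrow> 'a tensor \<Rightarrow> 'a tensor"  (infixl \<open>\<ast>\<close> 70)
  where "X \<ast> Y = hat X Y"

definition mc_mult_span :: "'a::euclidean_space tensor set \<Rightarrow> 'a tensor set \<Rightarrow> 'a tensor set"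
    (infixl \<open>\<ast>\<^sub>S\<close> 70)
  where "U\<^sub>1 \<ast>\<^sub>S U\<^sub>2 = span {X \<ast> Y | X Y. X \<in> U\<^sub>1 \<and> Y \<in> U\<^sub>2}"

text \<open>
  An orientation of \<open>V\<close> is given by its Euclidean volume form: one of the two top-degree alternating
  forms taking values \<open>1\<close> and \<open>-1\<close> on orthonormal bases, the value being \<open>1\<close> on the positively
  oriented ones.
\<close>

definition orthonormal :: "'a::euclidean_space list \<Rightarrow> bool"
  where "orthonormal vs \<longleftrightarrow>
    (\<forall>i<length vs. \<forall>j<length vs. vs ! i \<bullet> vs ! j = (if i = j then 1 else 0))"

definition volume_form :: "'a::euclidean_space tensor \<Rightarrow> bool"
  where "volume_form \<epsilon> \<longleftrightarrow> \<epsilon> \<in> alt_tensors DIM('a) \<and>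
    (\<forall>vs. length vs = DIM('a) \<longrightarrow> orthonormal vs \<longrightarrow> \<bar>\<epsilon> vs\<bar> = 1)"

text \<open>
  Hodge star on the first two indices. On rank 2 it is the usual star on two-forms, on rank 4 the star
  on curvature tensors. It is intended for \<open>DIM('a) = 4\<close>.
\<close>

definition hodge :: "'a::euclidean_space tensor \<Rightarrow> 'a tensor \<Rightarrow> 'a tensor"
  where "hodge \<epsilon> T = (\<lambda>vs. case vs of
      u # v # ws \<Rightarrow> (1 / 2) * (\<Sum>a\<in>Basis. \<Sum>b\<in>Basis. \<epsilon> [u, v, a, b] * T (a # b # ws))
    | _ \<Rightarrow> 0)"

text \<open>In the next two definitions the sign \<open>\<sigma>\<close> is \<open>1\<close> or \<open>-1\<close>.\<close>

definition Lambda2_sd :: "'a::euclidean_space tensor \<Rightarrow> real \<Rightarrow> 'a tensor set"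
  where "Lambda2_sd \<epsilon> \<sigma> = {\<alpha> \<in> alt_tensors 2. hodge \<epsilon> \<alpha> = \<sigma> *\<^sub>R \<alpha>}"

definition MCW_sd :: "'a::euclidean_space tensor \<Rightarrow> real \<Rightarrow> 'a tensor set"
  where "MCW_sd \<epsilon> \<sigma> = {X \<in> MCW. hodge \<epsilon> X = \<sigma> *\<^sub>R X}"

definition orth_proj :: "nat \<Rightarrow> 'a::euclidean_space tensor set \<Rightarrow> 'a tensor \<Rightarrow> 'a tensor"
  where "orth_proj k U \<alpha> = (THE \<beta>. \<beta> \<in> U \<and> (\<forall>\<gamma>\<in>U. tensor_inner k (\<alpha> - \<beta>) \<gamma> = 0))"

text \<open>
  Trace of an endomorphism \<open>A\<close> of a finite-dimensional subspace \<open>W\<close>: the sum of the diagonal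
  coefficients in a basis of \<open>W\<close>. The sum does not depend on the basis.
\<close>

definition trace_on :: "'b::real_vector set \<Rightarrow> ('b \<Rightarrow> 'b) \<Rightarrow> real"
  where "trace_on W A =
    (let B = (SOME B. independent B \<and> span B = W) in \<Sum>b\<in>B. representation B (A b) b)"

end

theory Submission
  imports Defs
begin

text \<open>
  In an oriented orthonormal frame let \<open>\<omega>\<^sub>1, \<omega>\<^sub>2, \<omega>\<^sub>3\<close> be the standard basis of
  \<open>\<Lambda>\<^sup>2\<^sub>\<plusminus>\<close>. The Bianchi identity makes a curvature tensor symmetric under exchange
  of its index pairs, so the (anti-)self-dual Weyl tensors are exactly the tensors
  \<open>\<Sum> A\<^sub>i\<^sub>j \<omega>\<^sub>i \<otimes> \<omega>\<^sub>j\<close> with \<open>A\<close> symmetric and traceless, and such a tensor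
  acts on two-forms as \<open>-2 A\<close> on \<open>\<Lambda>\<^sup>2\<^sub>\<plusminus>\<close> and as \<open>0\<close> on the complement. As
  skew endomorphisms the \<open>\<omega>\<^sub>i\<close> multiply like the imaginary quaternions and commute with those of
  the opposite duality. In \<open>X \<ast> Y\<close> the position pairs inside \<open>ij\<close> or \<open>kl\<close> contribute
  \<open>-(A B + B A)\<close>, while the four mixed ones combine to commutators \<open>[\<omega>\<^sub>i, \<omega>\<^sub>j]\<close>;
  altogether the matrix of \<open>X \<ast> Y\<close> is \<open>2 tr(A B) I - 3 (A B + B A)\<close>, and it is \<open>0\<close>
  for opposite dualities. These matrices span the traceless symmetric ones.
\<close>

section \<open>Permutations of tensor slots\<close>

text \<open>Composition with \<open>\<tau>\<close> reindexes the sum over the permutations of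
  \<open>I\<close> and multiplies each sign by \<open>sign \<tau>\<close>. The bound on
  \<open>I\<close> keeps the permutations inside the list, where \<open>permute_list\<close>
  respects composition.\<close>

lemma antisym_permute_list:
  assumes T: "antisym I T = T" and \<tau>: "\<tau> permutes I" and I: "finite I" "I \<subseteq> {..<length vs}"
  shows "T (permute_list \<tau> vs) = of_int (sign \<tau>) * T vs"
proof -
  have perm: "permutation \<pi>" if "\<pi> permutes I" for \<pi>
    using that I(1) by (auto simp: permutation_permutes)
  have "T (permute_list \<tau> vs) = (1 / fact (card I)) *
      (\<Sum>\<pi> | \<pi> permutes I. of_int (sign \<pi>) * T (permute_list \<pi> (permute_list \<tau> vs)))"
    by (subst T[symmetric]) (simp add: antisym_def)
  also have "(\<Sum>\<pi> | \<pi> permutes I. of_int (sign \<pi>) * T (permute_list \<pi> (permute_list \<tau> vs)))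
      = (\<Sum>\<pi> | \<pi> permutes I. of_int (sign \<tau>) *
          (of_int (sign (\<tau> \<circ> \<pi>)) * T (permute_list (\<tau> \<circ> \<pi>) vs)))"
  proof (rule sum.cong[OF refl], simp)
    fix \<pi> assume \<pi>: "\<pi> permutes I"
    have "\<pi> permutes {..<length vs}"
      using \<pi> I(2) by (rule permutes_subset)
    then show "of_int (sign \<pi>) * T (permute_list \<pi> (permute_list \<tau> vs)) =
      of_int (sign \<tau>) * (of_int (sign (\<tau> \<circ> \<pi>)) * T (permute_list (\<tau> \<circ> \<pi>) vs))"
      by (simp add: permute_list_compose sign_compose perm \<pi> \<tau> mult.assoc[symmetric] flip: of_int_mult)
  qed
  also have "\<dots> = of_int (sign \<tau>) *
      (\<Sum>\<pi> | \<pi> permutes I. of_int (sign \<pi>) * T (permute_list \<pi> vs))"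
    by (subst (2) setum_permutations_compose_left[OF \<tau>]) (simp add: sum_distrib_left)
  also have "(1 / fact (card I)) * \<dots> = of_int (sign \<tau>) * antisym I T vs"
    by (simp add: antisym_def)
  finally show ?thesis by (simp only: T)
qed

lemma antisym_transpose:
  assumes "antisym I T = T" "i \<in> I" "j \<in> I" "i \<noteq> j" "finite I" "I \<subseteq> {..<length vs}"
  shows "T (permute_list (Transposition.transpose i j) vs) = - T vs"
  using antisym_permute_list[of I T "Transposition.transpose i j" vs] assms
  by (simp add: permutes_swap_id sign_swap_id)

lemma antisym_2:
  assumes "i \<noteq> j"
  shows "antisym {i, j} T vs = (T vs - T (permute_list (Transposition.transpose i j) vs)) / 2"
  using assms
  by (simp add: antisym_def sum_over_permutations_insert sign_swap_id permutes_empty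
      sign_compose permutation_swap_id card_insert_if)

lemma antisym_2_iff:
  assumes "i \<noteq> j"
  shows "antisym {i, j} T = T \<longleftrightarrow> (\<forall>vs. T (permute_list (Transposition.transpose i j) vs) = - T vs)"
proof -
  have "(x - y) / 2 = x \<longleftrightarrow> y = - x" for x y :: real by auto
  then show ?thesis by (simp only: fun_eq_iff antisym_2[OF assms])
qed

text \<open>Permutations are generated by inserting one element at a time, which is why the 3-cycles
  appear as products of two transpositions.\<close>

lemma antisym_3:
  assumes "distinct [i, j, k]"
  shows "antisym {i, j, k} T vs = (T vs - T (permute_list (Transposition.transpose j k) vs)
     - T (permute_list (Transposition.transpose i j) vs) - T (permute_list (Transposition.transpose i k) vs)
     + T (permute_list (Transposition.transpose i j \<circ> Transposition.transpose j k) vs)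
     + T (permute_list (Transposition.transpose i k \<circ> Transposition.transpose j k) vs)) / 6"
  using assms
  by (simp add: antisym_def sum_over_permutations_insert sign_swap_id permutes_empty
      sign_compose permutation_swap_id card_insert_if permutation_compose fact_numeral)

lemma permute_list_two [simp]:
  "permute_list (Transposition.transpose 0 (Suc 0)) [a, b] = [b, a]"
  by (simp add: permute_list_def Transposition.transpose_def)

lemma permute_list_four [simp]:
  "permute_list (Transposition.transpose 0 (Suc 0)) [a, b, c, d] = [b, a, c, d]"
  "permute_list (Transposition.transpose 0 2) [a, b, c, d] = [c, b, a, d]"
  "permute_list (Transposition.transpose (Suc 0) 2) [a, b, c, d] = [a, c, b, d]"
  "permute_list (Transposition.transpose 2 3) [a, b, c, d] = [a, b, d, c]"
  "permute_list (Transposition.transpose 0 (Suc 0) \<circ> Transposition.transpose (Suc 0) 2) [a, b, c, d] = [b, c, a, d]"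
  "permute_list (Transposition.transpose 0 2 \<circ> Transposition.transpose (Suc 0) 2) [a, b, c, d] = [c, a, b, d]"
  by (simp_all add: permute_list_def Transposition.transpose_def upt_rec eval_nat_numeral)

section \<open>Multilinearity and the symmetries of curvature tensors\<close>

lemma length_2_iff: "length vs = 2 \<longleftrightarrow> (\<exists>a b. vs = [a, b])"
  by (auto simp: length_Suc_conv numeral_eq_Suc)

lemma length_4_iff: "length vs = 4 \<longleftrightarrow> (\<exists>a b c d. vs = [a, b, c, d])"
  by (auto simp: length_Suc_conv numeral_eq_Suc)

lemma tensors_2_iff:
  "T \<in> tensors 2 \<longleftrightarrow> (\<forall>vs. length vs \<noteq> 2 \<longrightarrow> T vs = 0) \<and> bilinear (\<lambda>u v. T [u, v])"
proof -
  have "(\<forall>vs i. length vs = 2 \<longrightarrow> i < 2 \<longrightarrow> linear (\<lambda>v. T (vs[i := v]))) \<longleftrightarrow>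
     (\<forall>a b. linear (\<lambda>v. T [v, b]) \<and> linear (\<lambda>v. T [a, v]))"
    unfolding length_2_iff less_2_cases_iff by fastforce
  then show ?thesis
    by (auto simp: tensors_def bilinear_def)
qed

text \<open>Linearity in four slots is grouped by index pairs because forms are later compared with
  \<open>bilinear_eq_stdbasis\<close>, one pair at a time.\<close>

lemma tensors_4_iff:
  "T \<in> tensors 4 \<longleftrightarrow> (\<forall>vs. length vs \<noteq> 4 \<longrightarrow> T vs = 0) \<and>
     (\<forall>c d. bilinear (\<lambda>u v. T [u, v, c, d])) \<and> (\<forall>a b. bilinear (\<lambda>u v. T [a, b, u, v]))"
proof -
  have less4: "i < 4 \<longleftrightarrow> i = 0 \<or> i = 1 \<or> i = 2 \<or> i = 3" for i :: nat by auto
  have "(\<forall>vs i. length vs = 4 \<longrightarrow> i < 4 \<longrightarrow> linear (\<lambda>v. T (vs[i := v]))) \<longleftrightarrow>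
     (\<forall>a b c d. linear (\<lambda>v. T [v, b, c, d]) \<and> linear (\<lambda>v. T [a, v, c, d])
        \<and> linear (\<lambda>v. T [a, b, v, d]) \<and> linear (\<lambda>v. T [a, b, c, v]))" (is "?l \<longleftrightarrow> ?r")
  proof
    assume l: ?l
    show ?r
    proof (intro allI conjI)
      fix a b c d
      show "linear (\<lambda>v. T [v, b, c, d])" "linear (\<lambda>v. T [a, v, c, d])"
        "linear (\<lambda>v. T [a, b, v, d])" "linear (\<lambda>v. T [a, b, c, v])"
        using l[rule_format, of "[a, b, c, d]" 0] l[rule_format, of "[a, b, c, d]" 1]
          l[rule_format, of "[a, b, c, d]" 2] l[rule_format, of "[a, b, c, d]" 3]
        by (simp_all add: numeral_eq_Suc)
    qed
  next
    assume r: ?r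
    show ?l
    proof (intro allI impI)
      fix vs :: "'a list" and i :: nat
      assume "length vs = 4" "i < 4"
      then obtain a b c d where "vs = [a, b, c, d]" "i = 0 \<or> i = 1 \<or> i = 2 \<or> i = 3"
        unfolding length_4_iff less4 by blast
      with r show "linear (\<lambda>v. T (vs[i := v]))"
        by (elim disjE) (simp_all add: numeral_eq_Suc)
    qed
  qed
  then show ?thesis
    by (auto simp: tensors_def bilinear_def)
qed

lemma alt_tensors_2_iff:
  "\<alpha> \<in> alt_tensors 2 \<longleftrightarrow> (\<forall>vs. length vs \<noteq> 2 \<longrightarrow> \<alpha> vs = 0) \<and>
     bilinear (\<lambda>u v. \<alpha> [u, v]) \<and> (\<forall>u v. \<alpha> [v, u] = - \<alpha> [u, v])"
proof -
  have two: "{..<2::nat} = {0, 1}" by auto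
  have "antisym {0, 1} \<alpha> = \<alpha> \<longleftrightarrow> (\<forall>u v. \<alpha> [v, u] = - \<alpha> [u, v])"
    if van: "\<forall>vs. length vs \<noteq> 2 \<longrightarrow> \<alpha> vs = 0"
  proof
    assume "antisym {0, 1} \<alpha> = \<alpha>"
    then have "\<alpha> (permute_list (Transposition.transpose 0 1) [u, v]) = - \<alpha> [u, v]" for u v
      unfolding antisym_2_iff[OF zero_neq_one] by blast
    then show "\<forall>u v. \<alpha> [v, u] = - \<alpha> [u, v]"
      unfolding One_nat_def permute_list_two by blast
  next
    assume as: "\<forall>u v. \<alpha> [v, u] = - \<alpha> [u, v]"
    show "antisym {0, 1} \<alpha> = \<alpha>"
    proof
      fix vs show "antisym {0, 1} \<alpha> vs = \<alpha> vs"
      proof (cases "length vs = 2")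
        case True
        then obtain a b where "vs = [a, b]" by (auto simp: length_2_iff)
        then show ?thesis using as[rule_format, of b a] by (simp add: antisym_2)
      qed (simp add: antisym_2 van)
    qed
  qed
  then show ?thesis
    unfolding alt_tensors_def mem_Collect_eq two tensors_2_iff by blast
qed

lemma MC_iff:
  "X \<in> MC \<longleftrightarrow> (\<forall>vs. length vs \<noteq> 4 \<longrightarrow> X vs = 0) \<and>
     (\<forall>c d. bilinear (\<lambda>u v. X [u, v, c, d])) \<and> (\<forall>a b. bilinear (\<lambda>u v. X [a, b, u, v])) \<and>
     (\<forall>a b c d. X [b, a, c, d] = - X [a, b, c, d]) \<and>
     (\<forall>a b c d. X [a, b, d, c] = - X [a, b, c, d]) \<and>
     (\<forall>a b c d. X [a, b, c, d] + X [b, c, a, d] + X [c, a, b, d] = 0)"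
proof (cases "\<forall>vs. length vs \<noteq> 4 \<longrightarrow> X vs = 0")
  case van: True
  have anti: "antisym {i, j} X = X \<longleftrightarrow>
      (\<forall>a b c d. X (permute_list (Transposition.transpose i j) [a, b, c, d]) = - X [a, b, c, d])"
    if "i \<noteq> j" for i j
  proof
    assume "antisym {i, j} X = X"
    then show "\<forall>a b c d. X (permute_list (Transposition.transpose i j) [a, b, c, d]) = - X [a, b, c, d]"
      unfolding antisym_2_iff[OF that] by blast
  next
    assume as: "\<forall>a b c d. X (permute_list (Transposition.transpose i j) [a, b, c, d]) = - X [a, b, c, d]"
    show "antisym {i, j} X = X"
    proof
      fix vs show "antisym {i, j} X vs = X vs"
      proof (cases "length vs = 4")
        case True
        then obtain a b c d where "vs = [a, b, c, d]" by (auto simp: length_4_iff)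
        then show ?thesis
          using as[rule_format, of a b c d] by (simp add: antisym_2[OF that])
      qed (simp add: antisym_2 van that)
    qed
  qed
  have bianchi: "antisym {0, 1, 2} X = 0 \<longleftrightarrow>
      (\<forall>a b c d. X [a, b, c, d] + X [b, c, a, d] + X [c, a, b, d] = 0)"
    if as: "\<forall>a b c d. X [b, a, c, d] = - X [a, b, c, d]"
  proof -
    \<comment> \<open>Antisymmetry in the first two slots turns each odd permutation into an even
      one, so the six terms are twice the cyclic sum and 2/6 = 1/3 remains.\<close>
    have *: "antisym {0, 1, 2} X [a, b, c, d]
        = (X [a, b, c, d] + X [b, c, a, d] + X [c, a, b, d]) / 3" for a b c d
      using as[rule_format, of a b c d] as[rule_format, of c a b d] as[rule_format, of b c a d]
      by (simp add: antisym_3)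
    have **: "antisym {0, 1, 2} X vs = 0" if "length vs \<noteq> 4" for vs
      using that van by (simp add: antisym_3)
    show ?thesis
    proof
      assume "antisym {0, 1, 2} X = 0"
      then show "\<forall>a b c d. X [a, b, c, d] + X [b, c, a, d] + X [c, a, b, d] = 0"
        using * by simp
    next
      assume "\<forall>a b c d. X [a, b, c, d] + X [b, c, a, d] + X [c, a, b, d] = 0"
      then have "antisym {0, 1, 2} X vs = 0" for vs
        using *[of "vs ! 0" "vs ! 1" "vs ! 2" "vs ! 3"] **[of vs]
        by (cases "length vs = 4") (auto simp: length_4_iff)
      then show "antisym {0, 1, 2} X = 0" by auto
    qed
  qed
  have 01: "antisym {0, 1} X = X \<longleftrightarrow> (\<forall>a b c d. X [b, a, c, d] = - X [a, b, c, d])"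
    using anti[of 0 1] unfolding One_nat_def permute_list_four by simp
  have 23: "antisym {2, 3} X = X \<longleftrightarrow> (\<forall>a b c d. X [a, b, d, c] = - X [a, b, c, d])"
    using anti[of 2 3] unfolding permute_list_four by simp
  show ?thesis
    unfolding MC_def tensors_4_iff mem_Collect_eq 01 23 using van bianchi by blast
next
  case False
  then show ?thesis
    by (simp only: MC_def tensors_4_iff mem_Collect_eq simp_thms)
qed

lemma
  assumes X: "X \<in> MC"
  shows MC_length: "length vs \<noteq> 4 \<Longrightarrow> X vs = 0"
    and MC_bilinear: "bilinear (\<lambda>u v. X [u, v, c, d])" "bilinear (\<lambda>u v. X [a, b, u, v])"
    and MC_swap: "X [b, a, c, d] = - X [a, b, c, d]" "X [a, b, d, c] = - X [a, b, c, d]"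
    and MC_bianchi: "X [a, b, c, d] + X [b, c, a, d] + X [c, a, b, d] = 0"
proof -
  note MC = X[unfolded MC_iff]
  show "length vs \<noteq> 4 \<Longrightarrow> X vs = 0"
    by (rule MC[THEN conjunct1, rule_format])
  note MC = MC[THEN conjunct2]
  show "bilinear (\<lambda>u v. X [u, v, c, d])"
    by (rule MC[THEN conjunct1, rule_format])
  note MC = MC[THEN conjunct2]
  show "bilinear (\<lambda>u v. X [a, b, u, v])"
    by (rule MC[THEN conjunct1, rule_format])
  note MC = MC[THEN conjunct2]
  show "X [b, a, c, d] = - X [a, b, c, d]"
    by (rule MC[THEN conjunct1, rule_format])
  note MC = MC[THEN conjunct2]
  show "X [a, b, d, c] = - X [a, b, c, d]"
    by (rule MC[THEN conjunct1, rule_format])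
  show "X [a, b, c, d] + X [b, c, a, d] + X [c, a, b, d] = 0"
    by (rule MC[THEN conjunct2, rule_format])
qed

text \<open>Of the Bianchi identities for the four cyclic shifts of \<open>a b c d\<close>, the
  first two minus the last two leave \<open>2 * X [a, b, c, d] - 2 * X [c, d, a, b]\<close>; all
  other terms cancel by antisymmetry.\<close>

lemma MC_pair_symmetric:
  assumes "X \<in> MC"
  shows "X [c, d, a, b] = X [a, b, c, d]"
proof -
  note s = MC_swap[OF assms] and b = MC_bianchi[OF assms]
  show ?thesis
    using b[of a b c d] b[of b c d a] b[of c d a b] b[of d a b c]
      s(2)[of b c a d] s(2)[of a b c d] s(2)[of c d a b] s(2)[of d b a c] s(1)[of b d a c]
      s(1)[of a c b d] s(2)[of a c b d] s(2)[of d a b c]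
    by linarith
qed

section \<open>Traces of operators given by functionals and vectors\<close>

text \<open>The basis in \<open>trace_on\<close> comes from a choice operator, so nothing explicit
  is known about it. Expanding each \<open>w i\<close> in that basis and exchanging the sums
  eliminates it. The finite set \<open>S\<close> only bounds the dimension.\<close>

lemma trace_on_finite_rank:
  fixes W :: "'b::real_vector set"
  assumes W: "subspace W" "W \<subseteq> span S" "finite S"
    and "finite I" and \<phi>: "\<And>i. i \<in> I \<Longrightarrow> linear (\<phi> i)" and w: "\<And>i. i \<in> I \<Longrightarrow> w i \<in> W"
    and L: "\<And>x. x \<in> W \<Longrightarrow> L x = (\<Sum>i\<in>I. \<phi> i x *\<^sub>R w i)"
  shows "trace_on W L = (\<Sum>i\<in>I. \<phi> i (w i))"
proof -
  define B where "B = (SOME B. independent B \<and> span B = W)"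
  have "\<exists>B. independent B \<and> span B = W"
    using maximal_independent_subset[of W] span_minimal[OF _ W(1)]
    by (metis subset_antisym)
  then have B: "independent B" "span B = W"
    unfolding B_def by (metis (mono_tags, lifting) someI_ex)+
  have "B \<subseteq> W"
    using B span_superset by blast
  then have fin: "finite B"
    using independent_span_bound[OF W(3) B(1)] W(2) by blast
  have "trace_on W L = (\<Sum>b\<in>B. representation B (L b) b)"
    by (simp add: trace_on_def B_def Let_def)
  also have "\<dots> = (\<Sum>b\<in>B. \<Sum>i\<in>I. \<phi> i b * representation B (w i) b)"
  proof (rule sum.cong[OF refl])
    fix b assume "b \<in> B"
    then show "representation B (L b) b = (\<Sum>i\<in>I. \<phi> i b * representation B (w i) b)"
      using \<open>B \<subseteq> W\<close> B w
      by (subst L) (auto simp: representation_sum representation_scale span_scale)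
  qed
  also have "\<dots> = (\<Sum>i\<in>I. \<Sum>b\<in>B. \<phi> i b * representation B (w i) b)"
    by (rule sum.swap)
  also have "\<dots> = (\<Sum>i\<in>I. \<phi> i (w i))"
  proof (rule sum.cong[OF refl])
    fix i assume i: "i \<in> I"
    have "\<phi> i (w i) = \<phi> i (\<Sum>b\<in>B. representation B (w i) b *\<^sub>R b)"
      using sum_representation_eq[OF B(1), of "w i" B] w[OF i] B fin by simp
    also have "\<dots> = (\<Sum>b\<in>B. \<phi> i b * representation B (w i) b)"
      using \<phi>[OF i] by (simp add: linear_sum linear_scale mult.commute)
    finally show "(\<Sum>b\<in>B. \<phi> i b * representation B (w i) b) = \<phi> i (w i)" ..
  qed
  finally show ?thesis .
qed

section \<open>The action \<open>hat\<close> on ranks 2 and 4\<close>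

lemma MC_flip:
  assumes "X \<in> MC"
  shows "X [p, b, a, q] = X [q, a, b, p]"
  using MC_pair_symmetric[OF assms, of p b a q] MC_swap(1)[OF assms, of a q p b]
    MC_swap(2)[OF assms, of q a b p] by simp

text \<open>The ordered position pairs (r, s) and (s, r) thus contribute equally to
  \<open>hat\<close>, and the prefactors 1/2 and 1/4 become 1 and 1/2 over unordered pairs.\<close>

lemma sum_sum_flip:
  assumes "X \<in> MC"
  shows "(\<Sum>p\<in>Basis. \<Sum>q\<in>Basis. X [p, b, a, q] * f q p) = (\<Sum>p\<in>Basis. \<Sum>q\<in>Basis. X [p, a, b, q] * f p q)"
  by (subst sum.swap) (simp add: MC_flip[OF assms, of _ b a])

lemma hat_2:
  assumes "X \<in> MC"
  shows "hat X \<alpha> [u, v] = (\<Sum>p\<in>Basis. \<Sum>q\<in>Basis. X [p, u, v, q] * \<alpha> [p, q])"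
proof -
  have S: "{(r, s). r < length [u, v] \<and> s < length [u, v] \<and> r \<noteq> s} = {(0, 1), (1, 0)}"
    by auto
  then show ?thesis
    using sum_sum_flip[OF assms, of v u "\<lambda>p q. \<alpha> [p, q]"]
    unfolding hat_def S by simp
qed

lemma hat_4:
  assumes "X \<in> MC"
  shows "hat X \<alpha> [a, b, c, d] = 1/2 * (
       (\<Sum>p\<in>Basis. \<Sum>q\<in>Basis. X [p, a, b, q] * \<alpha> [p, q, c, d])
     + (\<Sum>p\<in>Basis. \<Sum>q\<in>Basis. X [p, c, d, q] * \<alpha> [a, b, p, q])
     + (\<Sum>p\<in>Basis. \<Sum>q\<in>Basis. X [p, a, c, q] * \<alpha> [p, b, q, d])
     + (\<Sum>p\<in>Basis. \<Sum>q\<in>Basis. X [p, a, d, q] * \<alpha> [p, b, c, q])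
     + (\<Sum>p\<in>Basis. \<Sum>q\<in>Basis. X [p, b, c, q] * \<alpha> [a, p, q, d])
     + (\<Sum>p\<in>Basis. \<Sum>q\<in>Basis. X [p, b, d, q] * \<alpha> [a, p, c, q]))"
proof -
  \<comment> \<open>The twelve ordered pairs are listed without repetition so that the sum can be
    unfolded term by term.\<close>
  have S: "{(r, s). r < length [a, b, c, d] \<and> s < length [a, b, c, d] \<and> r \<noteq> s} =
     set (filter (\<lambda>(r, s). r \<noteq> s) (List.product [0..<4] [0..<4]))"
    by auto
  show ?thesis
    using sum_sum_flip[OF assms, of b a "\<lambda>p q. \<alpha> [p, q, c, d]"]
      sum_sum_flip[OF assms, of d c "\<lambda>p q. \<alpha> [a, b, p, q]"]
      sum_sum_flip[OF assms, of c a "\<lambda>p q. \<alpha> [p, b, q, d]"]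
      sum_sum_flip[OF assms, of d a "\<lambda>p q. \<alpha> [p, b, c, q]"]
      sum_sum_flip[OF assms, of c b "\<lambda>p q. \<alpha> [a, p, q, d]"]
      sum_sum_flip[OF assms, of d b "\<lambda>p q. \<alpha> [a, p, c, q]"]
    unfolding hat_def S
    by (subst sum.distinct_set_conv_list) (simp_all add: distinct_product upt_rec numeral_eq_Suc)
qed

section \<open>Oriented orthonormal frames and their two-forms\<close>

text \<open>Adjacent transpositions generate all permutations, so the sign rules and
  \<open>positive\<close> fix \<open>\<epsilon>\<close> on all frame vectors. Linearity is recorded
  for the first two slots, which are the free ones in \<open>hodge\<close>.\<close>

locale oriented_frame =
  fixes \<epsilon> :: "'a::euclidean_space tensor" and e0 e1 e2 e3 :: 'a
  assumes Basis_eq: "Basis = {e0, e1, e2, e3}"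
    and distinct: "distinct [e0, e1, e2, e3]"
    and swap_01: "\<And>a b c d. \<epsilon> [b, a, c, d] = - \<epsilon> [a, b, c, d]"
    and swap_12: "\<And>a b c d. \<epsilon> [a, c, b, d] = - \<epsilon> [a, b, c, d]"
    and swap_23: "\<And>a b c d. \<epsilon> [a, b, d, c] = - \<epsilon> [a, b, c, d]"
    and bilinear_\<epsilon>: "\<And>c d. bilinear (\<lambda>u v. \<epsilon> [u, v, c, d])"
    and positive: "\<epsilon> [e0, e1, e2, e3] = 1"

lemma volume_form_frame:
  fixes \<epsilon> :: "'a::euclidean_space tensor"
  assumes "DIM('a) = 4" "volume_form \<epsilon>"
  obtains e0 e1 e2 e3 where "oriented_frame \<epsilon> e0 e1 e2 e3"
proof -
  obtain bs :: "'a list" where bs: "set bs = Basis" "distinct bs"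
    using finite_distinct_list finite_Basis by blast
  with assms(1) have "length bs = 4"
    by (metis distinct_card)
  then obtain e0 e1 e2 e3 where bs_eq: "bs = [e0, e1, e2, e3]"
    unfolding length_4_iff by blast
  have \<epsilon>: "\<epsilon> \<in> tensors 4" "antisym {..<4} \<epsilon> = \<epsilon>"
    using assms by (auto simp: volume_form_def alt_tensors_def)
  have sw: "\<epsilon> (permute_list (Transposition.transpose i j) [a, b, c, d]) = - \<epsilon> [a, b, c, d]"
    if "i < 4" "j < 4" "i \<noteq> j" for i j a b c d
    using antisym_transpose[OF \<epsilon>(2), of i j "[a, b, c, d]"] that by simp
  have s01: "\<epsilon> [b, a, c, d] = - \<epsilon> [a, b, c, d]" for a b c d
    using sw[of 0 "Suc 0" a b c d] by simp
  have s12: "\<epsilon> [a, c, b, d] = - \<epsilon> [a, b, c, d]" for a b c d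
    using sw[of "Suc 0" 2 a b c d] by simp
  have s23: "\<epsilon> [a, b, d, c] = - \<epsilon> [a, b, c, d]" for a b c d
    using sw[of 2 3 a b c d] by simp
  have "orthonormal [e0, e1, e2, e3]"
  proof -
    have "bs ! i \<in> Basis" if "i < length bs" for i
      using bs nth_mem that by blast
    then have "orthonormal bs"
      using bs by (auto simp: orthonormal_def inner_Basis nth_eq_iff_index_eq)
    then show ?thesis by (simp only: bs_eq)
  qed
  then have "\<bar>\<epsilon> [e0, e1, e2, e3]\<bar> = 1"
    using assms by (simp add: volume_form_def)
  \<comment> \<open>If the value is -1, exchanging the first two frame vectors makes it 1.\<close>
  then have pos: "\<epsilon> [e0, e1, e2, e3] = 1 \<or> \<epsilon> [e1, e0, e2, e3] = 1"
    using s01[of e1 e0 e2 e3] by fastforce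
  have bil: "bilinear (\<lambda>u v. \<epsilon> [u, v, c, d])" for c d
    using \<epsilon>(1) by (simp add: tensors_4_iff)
  have Basis: "Basis = {e0, e1, e2, e3}" "Basis = {e1, e0, e2, e3}"
    "distinct [e0, e1, e2, e3]" "distinct [e1, e0, e2, e3]"
    using bs bs_eq by auto
  from pos show thesis
  proof
    assume "\<epsilon> [e0, e1, e2, e3] = 1"
    from oriented_frame.intro[OF Basis(1,3) s01 s12 s23 bil this] show thesis by (rule that)
  next
    assume "\<epsilon> [e1, e0, e2, e3] = 1"
    from oriented_frame.intro[OF Basis(2,4) s01 s12 s23 bil this] show thesis by (rule that)
  qed
qed

context oriented_frame
begin

lemma sum_Basis_eq: "(\<Sum>p\<in>Basis. f p) = f e0 + f e1 + f e2 + f e3"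
  using distinct by (simp add: Basis_eq add.assoc)

lemma inner_frame [simp]:
  "e0 \<bullet> e0 = 1" "e0 \<bullet> e1 = 0" "e0 \<bullet> e2 = 0" "e0 \<bullet> e3 = 0"
  "e1 \<bullet> e0 = 0" "e1 \<bullet> e1 = 1" "e1 \<bullet> e2 = 0" "e1 \<bullet> e3 = 0"
  "e2 \<bullet> e0 = 0" "e2 \<bullet> e1 = 0" "e2 \<bullet> e2 = 1" "e2 \<bullet> e3 = 0"
  "e3 \<bullet> e0 = 0" "e3 \<bullet> e1 = 0" "e3 \<bullet> e2 = 0" "e3 \<bullet> e3 = 1"
proof -
  have "e0 \<in> Basis" "e1 \<in> Basis" "e2 \<in> Basis" "e3 \<in> Basis" "distinct [e3, e2, e1, e0]"
    using distinct by (auto simp: Basis_eq)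
  then show
    "e0 \<bullet> e0 = 1" "e0 \<bullet> e1 = 0" "e0 \<bullet> e2 = 0" "e0 \<bullet> e3 = 0"
    "e1 \<bullet> e0 = 0" "e1 \<bullet> e1 = 1" "e1 \<bullet> e2 = 0" "e1 \<bullet> e3 = 0"
    "e2 \<bullet> e0 = 0" "e2 \<bullet> e1 = 0" "e2 \<bullet> e2 = 1" "e2 \<bullet> e3 = 0"
    "e3 \<bullet> e0 = 0" "e3 \<bullet> e1 = 0" "e3 \<bullet> e2 = 0" "e3 \<bullet> e3 = 1"
    using distinct by (simp_all add: inner_Basis)
qed

text \<open>For \<open>t = 1\<close> and \<open>t = -1\<close> the components of \<open>\<omega> t\<close> are the basis
  \<open>e\<^sup>0\<^sup>1 + t e\<^sup>2\<^sup>3\<close>, \<open>e\<^sup>0\<^sup>2 - t e\<^sup>1\<^sup>3\<close>,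
  \<open>e\<^sup>0\<^sup>3 + t e\<^sup>1\<^sup>2\<close> of the self-dual and the anti-self-dual two-forms.\<close>

definition \<omega> :: "real \<Rightarrow> 'a \<Rightarrow> 'a \<Rightarrow> real^3"
  where "\<omega> t u v = vector
    [(u \<bullet> e0) * (v \<bullet> e1) - (u \<bullet> e1) * (v \<bullet> e0) + t * ((u \<bullet> e2) * (v \<bullet> e3) - (u \<bullet> e3) * (v \<bullet> e2)),
     (u \<bullet> e0) * (v \<bullet> e2) - (u \<bullet> e2) * (v \<bullet> e0) - t * ((u \<bullet> e1) * (v \<bullet> e3) - (u \<bullet> e3) * (v \<bullet> e1)),
     (u \<bullet> e0) * (v \<bullet> e3) - (u \<bullet> e3) * (v \<bullet> e0) + t * ((u \<bullet> e1) * (v \<bullet> e2) - (u \<bullet> e2) * (v \<bullet> e1))]"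

lemma \<omega>_nth [simp]:
  "\<omega> t u v $ 1 = (u \<bullet> e0) * (v \<bullet> e1) - (u \<bullet> e1) * (v \<bullet> e0) + t * ((u \<bullet> e2) * (v \<bullet> e3) - (u \<bullet> e3) * (v \<bullet> e2))"
  "\<omega> t u v $ 2 = (u \<bullet> e0) * (v \<bullet> e2) - (u \<bullet> e2) * (v \<bullet> e0) - t * ((u \<bullet> e1) * (v \<bullet> e3) - (u \<bullet> e3) * (v \<bullet> e1))"
  "\<omega> t u v $ 3 = (u \<bullet> e0) * (v \<bullet> e3) - (u \<bullet> e3) * (v \<bullet> e0) + t * ((u \<bullet> e1) * (v \<bullet> e2) - (u \<bullet> e2) * (v \<bullet> e1))"
  by (simp_all add: \<omega>_def)

lemma \<omega>_swap: "\<omega> t v u = - \<omega> t u v"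
  by (simp add: vec_eq_iff forall_3 algebra_simps)

lemma bilinear_\<omega>: "bilinear (\<omega> t)"
  by (auto simp: bilinear_def vec_eq_iff forall_3 algebra_simps intro!: linearI)

lemma bilinear_inner_\<omega>: "bilinear (\<lambda>u v. x \<bullet> \<omega> t u v)" "bilinear (\<lambda>u v. \<omega> t u v \<bullet> x)"
  using bilinear_\<omega>[of t]
  by (auto simp: bilinear_def linear_iff inner_add_left inner_add_right)

text \<open>The factor is 4 for \<open>t * t' = 1\<close> and 0 for \<open>t * t' = -1\<close>: the
  norm of the basis forms, and the orthogonality of the two dualities.\<close>

lemma \<omega>_contract:
  "(\<Sum>p\<in>Basis. \<Sum>q\<in>Basis. (x \<bullet> \<omega> t p q) * (y \<bullet> \<omega> t' p q)) = 2 * (1 + t * t') * (x \<bullet> y)"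
  by (simp add: sum_Basis_eq inner_vec_def sum_3 algebra_simps)

text \<open>The sum over \<open>p\<close> is a product of skew matrices, so this is the commutator
  rule of imaginary quaternions; the sign of the structure constants depends on the duality
  \<open>t\<close>.\<close>

lemma \<omega>_commutator:
  assumes "t * t = 1"
  shows "(\<Sum>p\<in>Basis. \<omega> t u p $ c * \<omega> t p v $ a - \<omega> t u p $ a * \<omega> t p v $ c)
    = - 2 * t * (cross3 (axis c 1) (axis a 1) \<bullet> \<omega> t u v)"
proof -
  \<comment> \<open>The right-nested form lets simplification remove all even powers of
    \<open>t\<close>.\<close>
  have "t * (t * x) = x" for x using assms by (simp flip: mult.assoc)
  note tt = assms this
  have "\<forall>c a. (\<Sum>p\<in>Basis. \<omega> t u p $ c * \<omega> t p v $ a - \<omega> t u p $ a * \<omega> t p v $ c)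
    = - 2 * t * (cross3 (axis c 1) (axis a 1) \<bullet> \<omega> t u v)"
    unfolding forall_3
    by (simp add: sum_Basis_eq inner_vec_def sum_3 cross3_simps axis_def tt)
  then show ?thesis by blast
qed

text \<open>This reflects the splitting of so(4) into two commuting copies of so(3).\<close>

lemma \<omega>_commute:
  assumes "t * t = 1"
  shows "(\<Sum>p\<in>Basis. \<omega> t u p $ c * \<omega> (- t) p v $ a - \<omega> (- t) u p $ a * \<omega> t p v $ c) = 0"
proof -
  have "t * (t * x) = x" for x using assms by (simp flip: mult.assoc)
  note tt = assms this
  have "\<forall>c a. (\<Sum>p\<in>Basis. \<omega> t u p $ c * \<omega> (- t) p v $ a - \<omega> (- t) u p $ a * \<omega> t p v $ c) = 0"
    unfolding forall_3
    by (simp add: sum_Basis_eq algebra_simps tt)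
  then show ?thesis by blast
qed

end

section \<open>Contractions over basis vectors\<close>

lemma tensor_inner_2:
  "tensor_inner 2 S T = (\<Sum>p\<in>Basis. \<Sum>q\<in>Basis. S [p, q] * T [p, q])"
proof -
  have "{bs :: 'a list. length bs = 2 \<and> set bs \<subseteq> Basis} = (\<lambda>z. [fst z, snd z]) ` (Basis \<times> Basis)"
    unfolding length_2_iff by (auto simp: image_iff)
  moreover have "inj_on (\<lambda>z. [fst z, snd z]) (Basis \<times> Basis :: ('a \<times> 'a) set)"
    by (auto simp: inj_on_def)
  ultimately show ?thesis
    by (simp add: tensor_inner_def sum.reindex sum.cartesian_product case_prod_beta)
qed

lemma hat_length: 
  assumes "\<And>vs. length vs \<noteq> k \<Longrightarrow> \<alpha> vs = 0" and "length vs \<noteq> k"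
  shows "hat X \<alpha> vs = 0"
  using assms by (simp add: hat_def case_prod_beta)

lemma hat_add: "hat X (\<alpha> + \<beta>) = hat X \<alpha> + hat X \<beta>"
  by (simp add: hat_def fun_eq_iff case_prod_beta distrib_left sum.distrib add_divide_distrib)

text \<open>Pulls the matrix entries out of a contraction of two curvature tensors, so that the sums
  over \<open>p\<close> and \<open>q\<close> separate into a product. It serves the mixed position
  pairs of \<open>hat_4\<close>.\<close>

lemma sum_inner_matrix_mult:
  fixes A B :: "real^'n^'n" and f g h k :: "'b \<Rightarrow> real^'n"
  shows "(\<Sum>p\<in>P. \<Sum>q\<in>Q. (f p \<bullet> (A *v g q)) * (h p \<bullet> (B *v k q))) =
    (\<Sum>c\<in>UNIV. \<Sum>d\<in>UNIV. \<Sum>a\<in>UNIV. \<Sum>b\<in>UNIV. A $ c $ d * B $ a $ b *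
       ((\<Sum>p\<in>P. f p $ c * h p $ a) * (\<Sum>q\<in>Q. g q $ d * k q $ b)))"
proof -
  have inner: "x \<bullet> (M *v y) = (\<Sum>c\<in>UNIV. \<Sum>d\<in>UNIV. M $ c $ d * (x $ c * y $ d))"
    for M :: "real^'n^'n" and x y
    by (simp add: inner_vec_def matrix_vector_mult_def sum_distrib_left mult_ac)
  have "(\<Sum>p\<in>P. \<Sum>q\<in>Q. (f p \<bullet> (A *v g q)) * (h p \<bullet> (B *v k q))) =
    (\<Sum>p\<in>P. \<Sum>q\<in>Q. \<Sum>c\<in>UNIV. \<Sum>d\<in>UNIV. \<Sum>a\<in>UNIV. \<Sum>b\<in>UNIV. A $ c $ d * B $ a $ b *
       ((f p $ c * h p $ a) * (g q $ d * k q $ b)))"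
    unfolding inner unfolding sum_distrib_right unfolding sum_distrib_left
    by (intro sum.cong refl) (simp add: mult_ac)
  also have "\<dots> = (\<Sum>p\<in>P. \<Sum>c\<in>UNIV. \<Sum>d\<in>UNIV. \<Sum>a\<in>UNIV. \<Sum>b\<in>UNIV. \<Sum>q\<in>Q. A $ c $ d * B $ a $ b *
       ((f p $ c * h p $ a) * (g q $ d * k q $ b)))"
    by (simp only: sum.swap[where A = Q])
  \<comment> \<open>Restricting the exchange to sums over \<open>UNIV\<close> moves \<open>P\<close>
    past the matrix indices but not past \<open>Q\<close>.\<close>
  also have "\<dots> = (\<Sum>c\<in>UNIV. \<Sum>d\<in>UNIV. \<Sum>a\<in>UNIV. \<Sum>b\<in>UNIV. \<Sum>p\<in>P. \<Sum>q\<in>Q. A $ c $ d * B $ a $ b *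
       ((f p $ c * h p $ a) * (g q $ d * k q $ b)))"
    by (simp only: sum.swap[where A = P and B = UNIV])
  finally show ?thesis
    by (simp only: sum_product) (simp only: sum_distrib_left)
qed

section \<open>Traceless symmetric 3 by 3 matrices\<close>

definition traceless_symmetric :: "real^3^3 \<Rightarrow> bool"
  where "traceless_symmetric A \<longleftrightarrow> transpose A = A \<and> trace A = 0"

lemma traceless_symmetric_iff:
  "traceless_symmetric A \<longleftrightarrow> A $ 2 $ 1 = A $ 1 $ 2 \<and> A $ 3 $ 1 = A $ 1 $ 3 \<and> A $ 3 $ 2 = A $ 2 $ 3
     \<and> A $ 3 $ 3 = - A $ 1 $ 1 - A $ 2 $ 2"
  by (auto simp: traceless_symmetric_def vec_eq_iff forall_3 transpose_def trace_def sum_3)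

text \<open>This is -3 times the traceless part of \<open>A ** B + B ** A\<close>, whose trace is
  \<open>2 * trace (A ** B)\<close>.\<close>

definition jordan_prod :: "real^3^3 \<Rightarrow> real^3^3 \<Rightarrow> real^3^3"
  where "jordan_prod A B = (2 * trace (A ** B)) *\<^sub>R mat 1 - 3 *\<^sub>R (A ** B + B ** A)"

lemma traceless_symmetric_jordan_prod:
  assumes "traceless_symmetric A" "traceless_symmetric B"
  shows "traceless_symmetric (jordan_prod A B)"
  unfolding traceless_symmetric_iff
  by (simp add: assms[unfolded traceless_symmetric_iff] jordan_prod_def trace_def matrix_matrix_mult_def mat_def sum_3 algebra_simps)

text \<open>The quadruple sum is a polarized cofactor matrix; for traceless matrices it represents A
  B + B A - tr(A B) I, by the polarized Cayley-Hamilton identity. The cross products are those of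
  \<open>\<omega>_commutator\<close>.\<close>

lemma jordan_prod_cross3:
  assumes "traceless_symmetric A" "traceless_symmetric B"
  shows "x \<bullet> (jordan_prod A B *v y) = - (x \<bullet> (A *v (B *v y))) - (y \<bullet> (A *v (B *v x)))
    - 2 * (\<Sum>c\<in>UNIV. \<Sum>d\<in>UNIV. \<Sum>a\<in>UNIV. \<Sum>b\<in>UNIV. A $ c $ d * B $ a $ b *
        ((cross3 (axis c 1) (axis a 1) \<bullet> x) * (cross3 (axis d 1) (axis b 1) \<bullet> y)))"
  unfolding traceless_symmetric_iff
  by (simp add: assms[unfolded traceless_symmetric_iff] jordan_prod_def trace_def matrix_matrix_mult_def matrix_vector_mult_def
      inner_vec_def mat_def sum_3 cross3_simps axis_def algebra_simps)

section \<open>Two-forms and curvature tensors in coordinates\<close>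

context oriented_frame
begin

lemma Basis_cases:
  assumes "i \<in> Basis"
  obtains "i = e0" | "i = e1" | "i = e2" | "i = e3"
  using assms Basis_eq by blast

definition form2 :: "real \<Rightarrow> real^3 \<Rightarrow> 'a tensor"
  where "form2 t x vs = (if length vs = 2 then x \<bullet> \<omega> t (vs ! 0) (vs ! 1) else 0)"

definition curv :: "real \<Rightarrow> real^3^3 \<Rightarrow> 'a tensor"
  where "curv t A vs =
    (if length vs = 4 then \<omega> t (vs ! 0) (vs ! 1) \<bullet> (A *v \<omega> t (vs ! 2) (vs ! 3)) else 0)"

lemma form2_simps [simp]:
  "form2 t x [u, v] = x \<bullet> \<omega> t u v" "length vs \<noteq> 2 \<Longrightarrow> form2 t x vs = 0"
  by (simp_all add: form2_def)

lemma curv_simps [simp]: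
  "curv t A [a, b, c, d] = \<omega> t a b \<bullet> (A *v \<omega> t c d)" "length vs \<noteq> 4 \<Longrightarrow> curv t A vs = 0"
  by (simp_all add: curv_def)

lemma form2_eqI:
  assumes "\<And>vs. length vs \<noteq> 2 \<Longrightarrow> \<alpha> vs = 0" "\<And>u v. \<alpha> [u, v] = x \<bullet> \<omega> t u v"
  shows "\<alpha> = form2 t x"
proof
  fix vs show "\<alpha> vs = form2 t x vs"
    using assms by (cases "length vs = 2") (auto simp: length_2_iff)
qed

lemma curv_eqI:
  assumes "\<And>vs. length vs \<noteq> 4 \<Longrightarrow> X vs = 0"
    and "\<And>a b c d. X [a, b, c, d] = \<omega> t a b \<bullet> (A *v \<omega> t c d)"
  shows "X = curv t A"
proof
  fix vs show "X vs = curv t A vs"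
    using assms by (cases "length vs = 4") (auto simp: length_4_iff)
qed

lemma form2_linear:
  "form2 t x + form2 t y = form2 t (x + y)" "c *\<^sub>R form2 t x = form2 t (c *\<^sub>R x)"
  "form2 t x - form2 t y = form2 t (x - y)" "form2 t 0 = 0"
  by (auto simp: fun_eq_iff form2_def scaleR_fun_def inner_add_left inner_diff_left)

lemma curv_linear:
  "curv t A + curv t B = curv t (A + B)" "c *\<^sub>R curv t A = curv t (c *\<^sub>R A)"
  by (auto simp: fun_eq_iff curv_def scaleR_fun_def inner_add_right matrix_vector_mult_add_rdistrib
      scaleR_matrix_vector_assoc[symmetric])

lemma bilinear_inner_matrix_\<omega>: "bilinear (\<lambda>u v. x \<bullet> (A *v \<omega> t u v))"
  using bilinear_\<omega>[of t]
  by (auto simp: bilinear_def linear_iff inner_add_right matrix_vector_right_distrib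
      matrix_vector_mult_scaleR)

lemma form2_in_alt_tensors: "form2 t x \<in> alt_tensors 2"
  unfolding alt_tensors_2_iff
proof (intro conjI allI impI)
  show "form2 t x [v, u] = - form2 t x [u, v]" for u v
    by (simp add: \<omega>_swap[of t v u])
qed (simp_all add: bilinear_inner_\<omega>)

section \<open>The Hodge star in the frame\<close>

text \<open>Only pairs in decreasing order are instantiated, so rewriting sorts the arguments and
  terminates.\<close>

lemmas \<epsilon>_sort =
  swap_01[of e1 e0] swap_01[of e2 e0] swap_01[of e3 e0] swap_01[of e2 e1] swap_01[of e3 e1] swap_01[of e3 e2]
  swap_12[of _ e1 e0] swap_12[of _ e2 e0] swap_12[of _ e3 e0] swap_12[of _ e2 e1] swap_12[of _ e3 e1] swap_12[of _ e3 e2]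
  swap_23[of _ _ e1 e0] swap_23[of _ _ e2 e0] swap_23[of _ _ e3 e0] swap_23[of _ _ e2 e1] swap_23[of _ _ e3 e1] swap_23[of _ _ e3 e2]

lemma \<epsilon>_repeat:
  "\<epsilon> [a, a, c, d] = 0" "\<epsilon> [a, b, b, d] = 0" "\<epsilon> [a, b, c, c] = 0"
  using swap_01[of a a c d] swap_12[of a b b d] swap_23[of a b c c] by simp_all

lemmas \<epsilon>_eval = \<epsilon>_sort \<epsilon>_repeat positive

text \<open>The vector \<open>w\<close> lets one computation serve two-forms, with \<open>w\<close>
  their coordinates, and curvature tensors, with \<open>w = A *v \<omega> t c d\<close>.\<close>

lemma hodge_\<omega>:
  assumes "t * t = 1"
  shows "1/2 * (\<Sum>a\<in>Basis. \<Sum>b\<in>Basis. \<epsilon> [u, v, a, b] * (\<omega> t a b \<bullet> w)) = t * (\<omega> t u v \<bullet> w)"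
proof -
  have tt: "t * (t * x) = x" for x using assms by (simp flip: mult.assoc)
  have "(\<lambda>u v. 1/2 * (\<Sum>a\<in>Basis. \<Sum>b\<in>Basis. \<epsilon> [u, v, a, b] * (\<omega> t a b \<bullet> w)))
    = (\<lambda>u v. t * (\<omega> t u v \<bullet> w))"
  proof (rule bilinear_eq_stdbasis)
    show "bilinear (\<lambda>u v. 1/2 * (\<Sum>a\<in>Basis. \<Sum>b\<in>Basis. \<epsilon> [u, v, a, b] * (\<omega> t a b \<bullet> w)))"
      using bilinear_\<epsilon>
      by (auto simp: bilinear_def linear_iff sum.distrib sum_distrib_left add_divide_distrib algebra_simps)
    show "bilinear (\<lambda>u v. t * (\<omega> t u v \<bullet> w))"
      using bilinear_inner_\<omega>(2)[of t w]
      by (auto simp: bilinear_def linear_iff algebra_simps)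
    fix i j :: 'a assume "i \<in> Basis" "j \<in> Basis"
    then show "1/2 * (\<Sum>a\<in>Basis. \<Sum>b\<in>Basis. \<epsilon> [i, j, a, b] * (\<omega> t a b \<bullet> w)) = t * (\<omega> t i j \<bullet> w)"
      by (elim Basis_cases; simp add: sum_Basis_eq \<epsilon>_eval inner_vec_def sum_3 algebra_simps assms tt)
  qed
  then show ?thesis by meson
qed

lemma hodge_frame:
  assumes "\<And>a b. f b a = - f a b"
  shows "1/2 * (\<Sum>a\<in>Basis. \<Sum>b\<in>Basis. \<epsilon> [e0, e1, a, b] * f a b) = f e2 e3"
    "1/2 * (\<Sum>a\<in>Basis. \<Sum>b\<in>Basis. \<epsilon> [e0, e2, a, b] * f a b) = - f e1 e3"
    "1/2 * (\<Sum>a\<in>Basis. \<Sum>b\<in>Basis. \<epsilon> [e0, e3, a, b] * f a b) = f e1 e2"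
  by (simp_all add: sum_Basis_eq \<epsilon>_eval assms[of e3 e2] assms[of e2 e1] assms[of e3 e1])

text \<open>An alternating form is fixed by its six values on frame pairs, and the duality relations
  express three of them by the values with \<open>e0\<close> in the first slot.\<close>

lemma self_dual_form_eq:
  assumes f: "bilinear f" and anti: "\<And>a b. f b a = - f a b"
    and "f e2 e3 = t * f e0 e1" "f e1 e3 = - t * f e0 e2" "f e1 e2 = t * f e0 e3"
  shows "f u v = vector [f e0 e1, f e0 e2, f e0 e3] \<bullet> \<omega> t u v"
proof -
  have diag: "f a a = 0" for a using anti[of a a] by simp
  have "f = (\<lambda>u v. vector [f e0 e1, f e0 e2, f e0 e3] \<bullet> \<omega> t u v)"
  proof (rule bilinear_eq_stdbasis[OF f bilinear_inner_\<omega>(1)])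
    fix i j :: 'a assume "i \<in> Basis" "j \<in> Basis"
    then show "f i j = vector [f e0 e1, f e0 e2, f e0 e3] \<bullet> \<omega> t i j"
      by (elim Basis_cases; simp add: inner_vec_def sum_3 vector_3 diag assms(3-5)
          anti[of e1 e0] anti[of e2 e0] anti[of e3 e0] anti[of e3 e2] anti[of e2 e1] anti[of e3 e1])
  qed
  then show ?thesis by meson
qed

text \<open>Averages the two components that carry the same coordinate of \<open>form2 t x\<close>.
  For \<open>t * t = 1\<close> it vanishes on forms of the opposite duality.\<close>

definition coord :: "real \<Rightarrow> 'a tensor \<Rightarrow> real^3"
  where "coord t \<alpha> = (1/2) *\<^sub>R vector [\<alpha> [e0, e1] + t * \<alpha> [e2, e3],
     \<alpha> [e0, e2] - t * \<alpha> [e1, e3], \<alpha> [e0, e3] + t * \<alpha> [e1, e2]]"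

lemma linear_coord: "linear (\<lambda>\<alpha>. coord t \<alpha> $ i)"
proof -
  have "\<forall>i. linear (\<lambda>\<alpha>. coord t \<alpha> $ i)"
    unfolding forall_3
    by (auto simp: linear_iff coord_def vector_3 scaleR_fun_def field_simps)
  then show ?thesis by blast
qed

lemma coord_form2:
  assumes "t * t = 1"
  shows "coord t (form2 t x) = x"
  using assms
  by (simp_all add: coord_def vec_eq_iff forall_3 vector_3 inner_vec_def sum_3 algebra_simps flip: mult.assoc)

text \<open>Writing the dualities as \<open>t\<close> and \<open>- t\<close> makes the self-dual and
  the anti-self-dual case one statement, here and below.\<close>

lemma alt_tensors_2_decomp:
  assumes "t * t = 1" and \<alpha>: "\<alpha> \<in> alt_tensors 2"
  shows "\<alpha> = form2 t (coord t \<alpha>) + form2 (- t) (coord (- t) \<alpha>)"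
proof
  fix vs
  have tt: "t * (t * x) = x" for x using assms by (simp flip: mult.assoc)
  have bil: "bilinear (\<lambda>u v. \<alpha> [u, v])" and anti: "\<alpha> [v, u] = - \<alpha> [u, v]" for u v
    using \<alpha>[unfolded alt_tensors_2_iff] by blast+
  have diag: "\<alpha> [u, u] = 0" for u using anti[of u u] by simp
  have "(\<lambda>u v. \<alpha> [u, v]) = (\<lambda>u v. coord t \<alpha> \<bullet> \<omega> t u v + coord (- t) \<alpha> \<bullet> \<omega> (- t) u v)"
  proof (rule bilinear_eq_stdbasis[OF bil])
    show "bilinear (\<lambda>u v. coord t \<alpha> \<bullet> \<omega> t u v + coord (- t) \<alpha> \<bullet> \<omega> (- t) u v)"
      using bilinear_inner_\<omega>(1)[of "coord t \<alpha>" t] bilinear_inner_\<omega>(1)[of "coord (- t) \<alpha>" "- t"]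
      by (auto simp: bilinear_def linear_iff algebra_simps)
    fix i j :: 'a assume "i \<in> Basis" "j \<in> Basis"
    then show "\<alpha> [i, j] = coord t \<alpha> \<bullet> \<omega> t i j + coord (- t) \<alpha> \<bullet> \<omega> (- t) i j"
      by (elim Basis_cases; simp add: coord_def inner_vec_def sum_3 vector_3 diag tt field_simps
          anti[of e1 e0] anti[of e2 e0] anti[of e3 e0] anti[of e3 e2] anti[of e2 e1] anti[of e3 e1])
  qed
  then have "\<alpha> [u, v] = coord t \<alpha> \<bullet> \<omega> t u v + coord (- t) \<alpha> \<bullet> \<omega> (- t) u v" for u v
    by meson
  moreover have "\<alpha> vs = 0" if "length vs \<noteq> 2"
    using \<alpha>[unfolded alt_tensors_2_iff] that by blast
  ultimately show "\<alpha> vs = (form2 t (coord t \<alpha>) + form2 (- t) (coord (- t) \<alpha>)) vs"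
    by (cases "length vs = 2") (auto simp: length_2_iff)
qed

text \<open>Formulated for a bare bilinear \<open>f\<close> so that it applies to a curvature tensor
  with its last two arguments fixed.\<close>

lemma self_dual_of_hodge:
  assumes "t * t = 1" and f: "bilinear f" and anti: "\<And>a b. f b a = - f a b"
    and hodge: "\<And>u v. 1/2 * (\<Sum>a\<in>Basis. \<Sum>b\<in>Basis. \<epsilon> [u, v, a, b] * f a b) = t * f u v"
  shows "f u v = vector [f e0 e1, f e0 e2, f e0 e3] \<bullet> \<omega> t u v"
  using hodge_frame[of f, OF anti] hodge[of e0 e1] hodge[of e0 e2] hodge[of e0 e3]
  by (intro self_dual_form_eq[OF f anti]) simp_all

lemma Lambda2_sd_eq:
  assumes "t * t = 1"
  shows "Lambda2_sd \<epsilon> t = range (form2 t)"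
proof (intro equalityI subsetI)
  fix \<alpha> assume "\<alpha> \<in> Lambda2_sd \<epsilon> t"
  then have \<alpha>: "\<alpha> \<in> alt_tensors 2" and h: "hodge \<epsilon> \<alpha> = t *\<^sub>R \<alpha>"
    by (auto simp: Lambda2_sd_def)
  have "\<alpha> [u, v] = vector [\<alpha> [e0, e1], \<alpha> [e0, e2], \<alpha> [e0, e3]] \<bullet> \<omega> t u v" for u v
  proof (rule self_dual_of_hodge[OF assms])
    show "1/2 * (\<Sum>a\<in>Basis. \<Sum>b\<in>Basis. \<epsilon> [u, v, a, b] * \<alpha> [a, b]) = t * \<alpha> [u, v]" for u v
      using fun_cong[OF h, of "[u, v]"] by (simp add: hodge_def scaleR_fun_def)
  qed (use \<alpha>[unfolded alt_tensors_2_iff] in blast)+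
  then have "\<alpha> = form2 t (vector [\<alpha> [e0, e1], \<alpha> [e0, e2], \<alpha> [e0, e3]])"
    using \<alpha>[unfolded alt_tensors_2_iff] by (intro form2_eqI) blast+
  then show "\<alpha> \<in> range (form2 t)" by blast
next
  fix \<alpha> assume "\<alpha> \<in> range (form2 t)"
  then obtain x where \<alpha>: "\<alpha> = form2 t x" by blast
  have "hodge \<epsilon> \<alpha> vs = (t *\<^sub>R \<alpha>) vs" for vs
    using hodge_\<omega>[OF assms, of "vs ! 0" "vs ! 1" x]
    by (auto simp: hodge_def scaleR_fun_def \<alpha> inner_commute[of x] form2_def split: list.splits)
  then show "\<alpha> \<in> Lambda2_sd \<epsilon> t"
    using form2_in_alt_tensors by (auto simp: Lambda2_sd_def \<alpha>)
qed

section \<open>Weyl tensors of one duality as traceless symmetric matrices\<close>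

text \<open>\<open>K i j + K j i\<close> is the wedge product of the i-th and j-th basis forms: zero
  for distinct indices and the same multiple of the volume form for equal ones. A traceless
  symmetric matrix therefore contracts \<open>K\<close> to zero, which is the Bianchi
  identity.\<close>

lemma \<omega>_cyclic:
  fixes t :: real and a b c d :: 'a
  assumes "t * t = 1"
  defines "K \<equiv> \<lambda>i j. \<omega> t a b $ i * \<omega> t c d $ j + \<omega> t b c $ i * \<omega> t a d $ j + \<omega> t c a $ i * \<omega> t b d $ j"
  shows "K 2 1 = - K 1 2" "K 3 1 = - K 1 3" "K 3 2 = - K 2 3" "K 2 2 = K 1 1" "K 3 3 = K 1 1"
proof -
  have tt: "t * (t * x) = x" for x using assms by (simp flip: mult.assoc)
  show "K 2 1 = - K 1 2" "K 3 1 = - K 1 3" "K 3 2 = - K 2 3" "K 2 2 = K 1 1" "K 3 3 = K 1 1"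
    by (simp_all add: K_def algebra_simps tt)
qed

lemma curv_in_MCW_sd:
  assumes t: "t * t = 1" and A: "traceless_symmetric A"
  shows "curv t A \<in> MCW_sd \<epsilon> t"
proof -
  note A' = A[unfolded traceless_symmetric_iff]
  have tt: "t * (t * x) = x" for x using t by (simp flip: mult.assoc)
  have "curv t A \<in> MC"
    unfolding MC_iff
  proof (intro conjI allI impI)
    fix a b c d
    show "curv t A [b, a, c, d] = - curv t A [a, b, c, d]"
      by (simp add: \<omega>_swap[of t b a])
    show "curv t A [a, b, d, c] = - curv t A [a, b, c, d]"
      by (simp add: \<omega>_swap[of t d c] linear_neg[OF matrix_vector_mul_linear])
    show "curv t A [a, b, c, d] + curv t A [b, c, a, d] + curv t A [c, a, b, d] = 0"
    proof -
      define K where "K i j = \<omega> t a b $ i * \<omega> t c d $ j + \<omega> t b c $ i * \<omega> t a d $ j + \<omega> t c a $ i * \<omega> t b d $ j"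
        for i j
      have "curv t A [a, b, c, d] + curv t A [b, c, a, d] + curv t A [c, a, b, d] =
          A $ 1 $ 1 * (K 1 1 - K 3 3) + A $ 2 $ 2 * (K 2 2 - K 3 3) + A $ 1 $ 2 * (K 1 2 + K 2 1)
          + A $ 1 $ 3 * (K 1 3 + K 3 1) + A $ 2 $ 3 * (K 2 3 + K 3 2)"
        by (simp add: K_def A' inner_vec_def matrix_vector_mult_def sum_3 algebra_simps del: \<omega>_nth)
      also have "\<dots> = 0"
        using \<omega>_cyclic[OF t, of a b c d, folded K_def] by simp
      finally show ?thesis .
    qed
  qed (simp_all add: bilinear_inner_\<omega> bilinear_inner_matrix_\<omega>)
  \<comment> \<open>Symmetry of \<open>A\<close> leaves only anticommutators of the basis forms.
    These are multiples of the inner product, so the sum is a multiple of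
    \<open>trace A\<close>.\<close>
  moreover have "ricci (curv t A) vs = 0" for vs
  proof (cases "length vs = 2")
    case True
    then obtain u v where vs: "vs = [u, v]" unfolding length_2_iff by blast
    show ?thesis
      by (simp add: vs ricci_def A' sum_Basis_eq inner_vec_def matrix_vector_mult_def sum_3 algebra_simps t tt)
  qed (simp add: ricci_def)
  moreover have "hodge \<epsilon> (curv t A) vs = (t *\<^sub>R curv t A) vs" for vs
    using hodge_\<omega>[OF t, of "vs ! 0" "vs ! 1" "A *v \<omega> t (vs ! 2) (vs ! 3)"]
    by (auto simp: hodge_def scaleR_fun_def curv_def numeral_eq_Suc split: list.splits)
  ultimately show ?thesis
    by (auto simp: MCW_sd_def MCW_def fun_eq_iff)
qed

lemma MCW_sd_eq:
  assumes t: "t * t = 1"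
  shows "MCW_sd \<epsilon> t = curv t ` {A. traceless_symmetric A}"
proof (intro equalityI subsetI)
  fix X assume "X \<in> MCW_sd \<epsilon> t"
  then have X: "X \<in> MC" and ric: "ricci X = 0" and h: "hodge \<epsilon> X = t *\<^sub>R X"
    by (auto simp: MCW_sd_def MCW_def)
  have sd: "X [u, v, c, d] = vector [X [e0, e1, c, d], X [e0, e2, c, d], X [e0, e3, c, d]] \<bullet> \<omega> t u v"
    for u v c d
  proof (rule self_dual_of_hodge[OF t])
    show "1/2 * (\<Sum>a\<in>Basis. \<Sum>b\<in>Basis. \<epsilon> [u, v, a, b] * X [a, b, c, d]) = t * X [u, v, c, d]" for u v
      using fun_cong[OF h, of "[u, v, c, d]"] by (simp add: hodge_def scaleR_fun_def)
  qed (rule MC_bilinear(1)[OF X] MC_swap(1)[OF X])+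
  define A :: "real^3^3" where "A = vector
    [vector [X [e0, e1, e0, e1], X [e0, e1, e0, e2], X [e0, e1, e0, e3]],
     vector [X [e0, e2, e0, e1], X [e0, e2, e0, e2], X [e0, e2, e0, e3]],
     vector [X [e0, e3, e0, e1], X [e0, e3, e0, e2], X [e0, e3, e0, e3]]]"
  have "X [a, b, c, d] = \<omega> t a b \<bullet> (A *v \<omega> t c d)" for a b c d
  proof -
    \<comment> \<open>Pair symmetry carries the duality from the first index pair to the
      second.\<close>
    have row: "X [e0, e, c, d] = vector [X [e0, e, e0, e1], X [e0, e, e0, e2], X [e0, e, e0, e3]] \<bullet> \<omega> t c d" for e
      using sd[of c d e0 e] MC_pair_symmetric[OF X] by metis
    show ?thesis
      unfolding sd[of a b c d] row
      by (simp add: A_def matrix_vector_mult_def inner_vec_def sum_3 vector_3 algebra_simps)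
  qed
  then have "X = curv t A"
    by (intro curv_eqI MC_length[OF X])
  moreover have "traceless_symmetric A"
  proof -
    \<comment> \<open>Up to sign the trace of \<open>A\<close> is the Ricci component at
      \<open>e0\<close>, \<open>e0\<close>.\<close>
    have "X [e0, e0, e0, e0] = 0"
      using MC_swap(1)[OF X, of e0 e0] by simp
    then have "X [e0, e1, e0, e1] + X [e0, e2, e0, e2] + X [e0, e3, e0, e3] = 0"
      using fun_cong[OF ric, of "[e0, e0]"]
        MC_swap(1)[OF X, of e0 e1 e0 e1] MC_swap(1)[OF X, of e0 e2 e0 e2] MC_swap(1)[OF X, of e0 e3 e0 e3]
      by (simp add: ricci_def sum_Basis_eq)
    then show ?thesis
      unfolding traceless_symmetric_iff A_def
      using MC_pair_symmetric[OF X, of e0 e1 e0 e2] MC_pair_symmetric[OF X, of e0 e1 e0 e3]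
        MC_pair_symmetric[OF X, of e0 e2 e0 e3]
      by (simp add: vector_3)
  qed
  ultimately show "X \<in> curv t ` {A. traceless_symmetric A}" by blast
qed (use curv_in_MCW_sd[OF t] in blast)

text \<open>The coordinates of \<open>\<omega> t\<close> multiply like the imaginary quaternions, and those of
  \<open>\<omega> t\<close> commute with those of \<open>\<omega> (- t)\<close>.\<close>

lemma \<omega>_triple_product:
  fixes t t' :: real and u v :: 'a
  defines "S \<equiv> \<lambda>c d a. \<Sum>p\<in>Basis. \<Sum>q\<in>Basis. \<omega> t p u $ c * \<omega> t v q $ d * \<omega> t' p q $ a"
  assumes t: "t * t = 1"
  shows "t' = t \<Longrightarrow> S c d a + S d c a =
      2 * (of_bool (c = d) * \<omega> t u v $ a - of_bool (a = c) * \<omega> t u v $ d - of_bool (a = d) * \<omega> t u v $ c)"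
    and "t' = - t \<Longrightarrow> S c d a + S d c a = - 2 * of_bool (c = d) * \<omega> t' u v $ a"
proof -
  have tt: "t * (t * x) = x" for x using t by (simp flip: mult.assoc)
  have "\<forall>c d a. S c d a + S d c a =
      2 * (of_bool (c = d) * \<omega> t u v $ a - of_bool (a = c) * \<omega> t u v $ d - of_bool (a = d) * \<omega> t u v $ c)"
    if "t' = t"
    unfolding forall_3 S_def that
    by (intro conjI; simp add: sum_Basis_eq algebra_simps t tt)
  then show "t' = t \<Longrightarrow> S c d a + S d c a =
      2 * (of_bool (c = d) * \<omega> t u v $ a - of_bool (a = c) * \<omega> t u v $ d - of_bool (a = d) * \<omega> t u v $ c)"
    by blast
  have "\<forall>c d a. S c d a + S d c a = - 2 * of_bool (c = d) * \<omega> t' u v $ a" if "t' = - t"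
    unfolding forall_3 S_def that
    by (intro conjI; simp add: sum_Basis_eq algebra_simps t tt)
  then show "t' = - t \<Longrightarrow> S c d a + S d c a = - 2 * of_bool (c = d) * \<omega> t' u v $ a"
    by blast
qed

section \<open>The action of Weyl tensors on two-forms\<close>

text \<open>In \<open>\<omega>_triple_product\<close> the terms with \<open>c = d\<close> sum to a
  multiple of the trace of \<open>A\<close> and disappear. For equal dualities the two other terms
  each give -A x; for opposite ones nothing else is present.\<close>

lemma curv_contract:
  fixes u v :: 'a
  assumes t: "t * t = 1" and A: "traceless_symmetric A"
  shows "(\<Sum>p\<in>Basis. \<Sum>q\<in>Basis. (\<omega> t p u \<bullet> (A *v \<omega> t v q)) * (x \<bullet> \<omega> t p q))
      = - 2 * ((A *v x) \<bullet> \<omega> t u v)"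
    and "(\<Sum>p\<in>Basis. \<Sum>q\<in>Basis. (\<omega> t p u \<bullet> (A *v \<omega> t v q)) * (x \<bullet> \<omega> (- t) p q)) = 0"
proof -
  note A' = A[unfolded traceless_symmetric_iff]
  define S where "S t' c d a = (\<Sum>p\<in>Basis. \<Sum>q\<in>Basis. \<omega> t p u $ c * \<omega> t v q $ d * \<omega> t' p q $ a)"
    for t' c d a
  \<comment> \<open>Symmetry of \<open>A\<close> pairs \<open>S c d a\<close> with
    \<open>S d c a\<close>; the entry \<open>A $ 3 $ 3\<close> is eliminated by
    tracelessness.\<close>
  have expand: "(\<Sum>p\<in>Basis. \<Sum>q\<in>Basis. (\<omega> t p u \<bullet> (A *v \<omega> t v q)) * (x \<bullet> \<omega> t' p q)) =
    (\<Sum>a\<in>UNIV. x $ a * (A $ 1 $ 1 * ((S t' 1 1 a + S t' 1 1 a) - (S t' 3 3 a + S t' 3 3 a)) / 2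
       + A $ 2 $ 2 * ((S t' 2 2 a + S t' 2 2 a) - (S t' 3 3 a + S t' 3 3 a)) / 2
       + A $ 1 $ 2 * (S t' 1 2 a + S t' 2 1 a)
       + A $ 1 $ 3 * (S t' 1 3 a + S t' 3 1 a) + A $ 2 $ 3 * (S t' 2 3 a + S t' 3 2 a)))" for t'
    unfolding sum_3 S_def
    by (simp only: sum_distrib_left sum_divide_distrib flip: sum.distrib sum_subtractf)
      (intro sum.cong refl, simp add: A' inner_vec_def matrix_vector_mult_def sum_3 field_simps del: \<omega>_nth)
  show "(\<Sum>p\<in>Basis. \<Sum>q\<in>Basis. (\<omega> t p u \<bullet> (A *v \<omega> t v q)) * (x \<bullet> \<omega> t p q))
      = - 2 * ((A *v x) \<bullet> \<omega> t u v)"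
    unfolding expand unfolding S_def \<omega>_triple_product(1)[OF t refl]
    by (simp add: A' inner_vec_def matrix_vector_mult_def sum_3 algebra_simps del: \<omega>_nth)
  show "(\<Sum>p\<in>Basis. \<Sum>q\<in>Basis. (\<omega> t p u \<bullet> (A *v \<omega> t v q)) * (x \<bullet> \<omega> (- t) p q)) = 0"
    unfolding expand unfolding S_def \<omega>_triple_product(2)[OF t refl]
    by (simp add: sum_3 del: \<omega>_nth)
qed

lemma hat_curv_form2:
  assumes t: "t * t = 1" and A: "traceless_symmetric A"
  shows "hat (curv t A) (form2 t x) = form2 t (- 2 *\<^sub>R (A *v x))"
    and "hat (curv t A) (form2 (- t) x) = 0"
proof -
  have "curv t A \<in> MC"
    using curv_in_MCW_sd[OF t A] by (simp add: MCW_sd_def MCW_def)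
  note hat = hat_2[OF this]
  show "hat (curv t A) (form2 t x) = form2 t (- 2 *\<^sub>R (A *v x))"
    by (rule form2_eqI) (simp_all add: hat hat_length[of 2] curv_contract[OF t A])
  have "hat (curv t A) (form2 (- t) x) = form2 t 0"
    by (rule form2_eqI) (simp_all add: hat hat_length[of 2] curv_contract[OF t A])
  then show "hat (curv t A) (form2 (- t) x) = 0"
    by (simp add: form2_linear)
qed

end

lemma subspace_alt_tensors_2: "subspace (alt_tensors 2)"
proof (rule subspaceI)
  note D = alt_tensors_2_iff[THEN iffD1]
  show "0 \<in> alt_tensors 2"
    by (simp add: alt_tensors_2_iff bilinear_def linear_iff)
  show "\<alpha> + \<beta> \<in> alt_tensors 2" if "\<alpha> \<in> alt_tensors 2" "\<beta> \<in> alt_tensors 2" for \<alpha> \<beta> :: "'a tensor"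
    unfolding alt_tensors_2_iff
  proof (intro conjI allI impI)
    show "bilinear (\<lambda>u v. (\<alpha> + \<beta>) [u, v])"
      using D[OF that(1), THEN conjunct2, THEN conjunct1] D[OF that(2), THEN conjunct2, THEN conjunct1]
      by (simp add: bilinear_def linear_iff algebra_simps)
    show "(\<alpha> + \<beta>) [v, u] = - (\<alpha> + \<beta>) [u, v]" for u v
      using D[OF that(1), THEN conjunct2, THEN conjunct2, rule_format, of v u]
        D[OF that(2), THEN conjunct2, THEN conjunct2, rule_format, of v u] by simp
  qed (use D[OF that(1), THEN conjunct1] D[OF that(2), THEN conjunct1] in simp)
  show "c *\<^sub>R \<alpha> \<in> alt_tensors 2" if "\<alpha> \<in> alt_tensors 2" for c and \<alpha> :: "'a tensor"
    unfolding alt_tensors_2_iff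
  proof (intro conjI allI impI)
    show "bilinear (\<lambda>u v. (c *\<^sub>R \<alpha>) [u, v])"
      using D[OF that, THEN conjunct2, THEN conjunct1]
      by (simp add: bilinear_def linear_iff scaleR_fun_def algebra_simps)
    show "(c *\<^sub>R \<alpha>) [v, u] = - (c *\<^sub>R \<alpha>) [u, v]" for u v
      using D[OF that, THEN conjunct2, THEN conjunct2, rule_format, of v u] by (simp add: scaleR_fun_def)
  qed (use D[OF that, THEN conjunct1] in \<open>simp add: scaleR_fun_def\<close>)
qed

section \<open>Jordan products span the traceless symmetric matrices\<close>

lemma traceless_symmetric_inner:
  assumes "traceless_symmetric A"
  shows "x \<bullet> (A *v y) = (A *v x) \<bullet> y"
  by (simp add: assms[unfolded traceless_symmetric_iff] inner_vec_def matrix_vector_mult_def sum_3 algebra_simps)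

lemma traceless_symmetric_span:
  assumes A: "traceless_symmetric A"
  shows "A \<in> span {jordan_prod M N | M N. traceless_symmetric M \<and> traceless_symmetric N}" (is "A \<in> span ?J")
proof -
  define d :: "real \<Rightarrow> real \<Rightarrow> real \<Rightarrow> real^3^3"
    where "d a b c = vector [vector [a, 0, 0], vector [0, b, 0], vector [0, 0, c]]" for a b c
  define e :: "real \<Rightarrow> real \<Rightarrow> real \<Rightarrow> real^3^3"
    where "e a b c = vector [vector [0, a, b], vector [a, 0, c], vector [b, c, 0]]" for a b c
  have d: "traceless_symmetric (d a b (- a - b))" for a b
    by (simp add: traceless_symmetric_iff d_def vector_3)
  have e: "traceless_symmetric (e a b c)" for a b c
    by (simp add: traceless_symmetric_iff e_def vector_3)
  let ?P = "\<lambda>a b. jordan_prod (d a b (- a - b)) (d a b (- a - b))"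
  let ?Q = "\<lambda>a b c x y. jordan_prod (e a b c) (d x y (- x - y))"
  note eval = vec_eq_iff forall_3 jordan_prod_def d_def e_def matrix_matrix_mult_def mat_def trace_def sum_3 vector_3
  \<comment> \<open>The square of diag(0, 1, -1) is diag(0, 1, 1), of trace 2. Combining the three
    results with the diagonal of \<open>A\<close> gives 6 times that diagonal, because the trace of
    \<open>A\<close> is 0.\<close>
  have P: "?P 0 1 = d 4 (- 2) (- 2)" "?P 1 0 = d (- 2) 4 (- 2)" "?P 1 (- 1) = d (- 2) (- 2) 4"
    by (simp_all add: eval)
  \<comment> \<open>The diagonal factor has the entry 1 in both rows coupled by \<open>e\<close>, so
    the anticommutator doubles \<open>e\<close> and the product is -6 times it.\<close>
  have Q: "?Q 1 0 0 1 1 = e (- 6) 0 0" "?Q 0 1 0 1 (- 2) = e 0 (- 6) 0" "?Q 0 0 1 (- 2) 1 = e 0 0 (- 6)"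
    by (simp_all add: eval)
  have "A = (1/6) *\<^sub>R (A $ 1 $ 1 *\<^sub>R ?P 0 1 + A $ 2 $ 2 *\<^sub>R ?P 1 0 + A $ 3 $ 3 *\<^sub>R ?P 1 (- 1)
      - A $ 1 $ 2 *\<^sub>R ?Q 1 0 0 1 1 - A $ 1 $ 3 *\<^sub>R ?Q 0 1 0 1 (- 2) - A $ 2 $ 3 *\<^sub>R ?Q 0 0 1 (- 2) 1)"
    unfolding P Q
    by (simp add: A[unfolded traceless_symmetric_iff] vec_eq_iff forall_3 d_def e_def vector_3)
  also have "\<dots> \<in> span ?J"
  proof -
    have mem: "jordan_prod M N \<in> span ?J" if "traceless_symmetric M" "traceless_symmetric N" for M N
      by (rule span_base) (use that in blast)
    show ?thesis
      by (intro span_scale span_add span_diff mem d e)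
  qed
  finally show ?thesis .
qed

section \<open>Products of Weyl tensors\<close>

context oriented_frame
begin

text \<open>The four terms are the products of a half of \<open>M\<close> with a half of
  \<open>N\<close>. The signs from skewness of \<open>\<omega>\<close> are exactly those that
  assemble them into minus a product of two commutators.\<close>

lemma curv_cross_terms:
  fixes t t' :: real and a b c d :: 'a
  defines "M \<equiv> \<lambda>i j. \<Sum>p\<in>Basis. \<omega> t a p $ i * \<omega> t' p b $ j - \<omega> t' a p $ j * \<omega> t p b $ i"
    and "N \<equiv> \<lambda>i j. \<Sum>p\<in>Basis. \<omega> t c p $ i * \<omega> t' p d $ j - \<omega> t' c p $ j * \<omega> t p d $ i"
  shows "(\<Sum>p\<in>Basis. \<Sum>q\<in>Basis. curv t A [p, a, c, q] * curv t' B [p, b, q, d])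
     + (\<Sum>p\<in>Basis. \<Sum>q\<in>Basis. curv t A [p, a, d, q] * curv t' B [p, b, c, q])
     + (\<Sum>p\<in>Basis. \<Sum>q\<in>Basis. curv t A [p, b, c, q] * curv t' B [a, p, q, d])
     + (\<Sum>p\<in>Basis. \<Sum>q\<in>Basis. curv t A [p, b, d, q] * curv t' B [a, p, c, q])
     = - (\<Sum>i\<in>UNIV. \<Sum>j\<in>UNIV. \<Sum>k\<in>UNIV. \<Sum>l\<in>UNIV. A $ i $ j * B $ k $ l * (M i k * N j l))"
proof -
  define M1 where "M1 i k = (\<Sum>p\<in>Basis. \<omega> t a p $ i * \<omega> t' p b $ k)" for i k
  define M2 where "M2 i k = (\<Sum>p\<in>Basis. \<omega> t' a p $ k * \<omega> t p b $ i)" for i k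
  define N1 where "N1 i k = (\<Sum>p\<in>Basis. \<omega> t c p $ i * \<omega> t' p d $ k)" for i k
  define N2 where "N2 i k = (\<Sum>p\<in>Basis. \<omega> t' c p $ k * \<omega> t p d $ i)" for i k
  have 1: "(\<Sum>p\<in>Basis. \<omega> t p a $ i * \<omega> t' p b $ k) = - M1 i k" for i k
    by (simp add: M1_def \<omega>_swap[of t _ a] sum_negf)
  have 2: "(\<Sum>p\<in>Basis. \<omega> t p b $ i * \<omega> t' a p $ k) = M2 i k" for i k
    by (simp add: M2_def mult.commute)
  have 3: "(\<Sum>p\<in>Basis. \<omega> t d p $ i * \<omega> t' c p $ k) = - N2 i k" for i k
    by (simp add: N2_def \<omega>_swap[of t d] sum_negf mult.commute)
  have MN: "M i k = M1 i k - M2 i k" "N i k = N1 i k - N2 i k" for i k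
    by (simp_all add: M_def N_def M1_def M2_def N1_def N2_def sum_subtractf)
  show ?thesis
    unfolding curv_simps sum_inner_matrix_mult 1 2 3 MN N1_def[symmetric]
    by (simp only: flip: sum.distrib sum_negf) (intro sum.cong refl, simp add: algebra_simps)
qed

lemma curv_mult:
  assumes t: "t * t = 1" and A: "traceless_symmetric A" and B: "traceless_symmetric B"
  shows "curv t A \<ast> curv t B = curv t (jordan_prod A B)"
    and "curv t A \<ast> curv (- t) B = 0"
proof -
  have MC: "curv t A \<in> MC"
    using curv_in_MCW_sd[OF t A] by (simp add: MCW_sd_def MCW_def)
  \<comment> \<open>Symmetry of \<open>B\<close> brings the pairs inside \<open>a b\<close> and
    inside \<open>c d\<close> to the shape of \<open>curv_contract\<close>.\<close>
  have within: "(\<Sum>p\<in>Basis. \<Sum>q\<in>Basis. curv t A [p, a, b, q] * curv t' B [p, q, c, d])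
      = (\<Sum>p\<in>Basis. \<Sum>q\<in>Basis. (\<omega> t p a \<bullet> (A *v \<omega> t b q)) * ((B *v \<omega> t' c d) \<bullet> \<omega> t' p q))"
    "(\<Sum>p\<in>Basis. \<Sum>q\<in>Basis. curv t A [p, c, d, q] * curv t' B [a, b, p, q])
      = (\<Sum>p\<in>Basis. \<Sum>q\<in>Basis. (\<omega> t p c \<bullet> (A *v \<omega> t d q)) * ((B *v \<omega> t' a b) \<bullet> \<omega> t' p q))"
    for a b c d t'
    by (simp_all only: curv_simps inner_commute[of _ "B *v \<omega> t' c d"]
        traceless_symmetric_inner[OF B, of "\<omega> t' a b"])
  have prod: "(curv t A \<ast> curv t' B) [a, b, c, d] = 1/2 * (
      (\<Sum>p\<in>Basis. \<Sum>q\<in>Basis. (\<omega> t p a \<bullet> (A *v \<omega> t b q)) * ((B *v \<omega> t' c d) \<bullet> \<omega> t' p q))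
    + (\<Sum>p\<in>Basis. \<Sum>q\<in>Basis. (\<omega> t p c \<bullet> (A *v \<omega> t d q)) * ((B *v \<omega> t' a b) \<bullet> \<omega> t' p q))
    - (\<Sum>i\<in>UNIV. \<Sum>j\<in>UNIV. \<Sum>k\<in>UNIV. \<Sum>l\<in>UNIV. A $ i $ j * B $ k $ l *
        ((\<Sum>p\<in>Basis. \<omega> t a p $ i * \<omega> t' p b $ k - \<omega> t' a p $ k * \<omega> t p b $ i) *
         (\<Sum>p\<in>Basis. \<omega> t c p $ j * \<omega> t' p d $ l - \<omega> t' c p $ l * \<omega> t p d $ j))))"
    for a b c d t'
  proof -
    have assoc: "1/2 * (x + y + z1 + z2 + z3 + z4) = 1/2 * (x + y - r)" if "z1 + z2 + z3 + z4 = - r"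
      for x y z1 z2 z3 z4 r :: real
      using that by simp
    show ?thesis
      unfolding mc_mult_def hat_4[OF MC] within by (rule assoc[OF curv_cross_terms])
  qed
  have len: "(curv t A \<ast> curv t' B) vs = 0" if "length vs \<noteq> 4" for t' vs
    using that by (simp add: mc_mult_def hat_length[of 4])
  show "curv t A \<ast> curv t B = curv t (jordan_prod A B)"
  proof (rule curv_eqI[OF len])
    fix a b c d :: 'a
    \<comment> \<open>The factors \<open>- 2 * t\<close> of the two commutators multiply to
      4.\<close>
    have sq: "(- 2 * t * x) * (- 2 * t * y) = 4 * (x * y)" for x y
    proof -
      have "(- 2 * t * x) * (- 2 * t * y) = 4 * (t * t) * (x * y)" by simp
      then show ?thesis by (simp add: t)
    qed
    have sum4: "(\<Sum>i\<in>UNIV. \<Sum>j\<in>UNIV. \<Sum>k\<in>UNIV. \<Sum>l\<in>UNIV. A $ i $ j * B $ k $ l * (4 * f i j k l))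
       = 4 * (\<Sum>i\<in>UNIV. \<Sum>j\<in>UNIV. \<Sum>k\<in>UNIV. \<Sum>l\<in>UNIV. A $ i $ j * B $ k $ l * f i j k l)"
      for f :: "3 \<Rightarrow> 3 \<Rightarrow> 3 \<Rightarrow> 3 \<Rightarrow> real"
      unfolding sum_distrib_left by (intro sum.cong refl) simp
    show "(curv t A \<ast> curv t B) [a, b, c, d] = \<omega> t a b \<bullet> (jordan_prod A B *v \<omega> t c d)"
      unfolding prod jordan_prod_cross3[OF A B] curv_contract(1)[OF t A] \<omega>_commutator[OF t] sq sum4
      by (simp add: inner_commute)
  qed
  \<comment> \<open>The inner pairs vanish because \<open>curv t A\<close> annihilates forms of the
    opposite duality, the mixed pairs because the commutators are zero.\<close>
  have "(curv t A \<ast> curv (- t) B) [a, b, c, d] = 0" for a b c d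
    unfolding prod curv_contract(2)[OF t A] \<omega>_commute[OF t] by simp
  then have "(curv t A \<ast> curv (- t) B) vs = 0" for vs
    using len by (cases "length vs = 4") (auto simp: length_4_iff)
  then show "curv t A \<ast> curv (- t) B = 0" by auto
qed

section \<open>Projections and traces on two-forms\<close>

lemma linear_form2: "linear (form2 t)"
  by (rule linearI) (simp_all add: form2_linear)

lemma linear_curv: "linear (curv t)"
  by (rule linearI) (simp_all add: curv_linear)

lemma orth_proj_Lambda2_sd:
  assumes t: "t * t = 1"
  shows "orth_proj 2 (Lambda2_sd \<epsilon> t) (form2 t x + form2 (- t) y) = form2 t x"
proof -
  have inner: "tensor_inner 2 (form2 t' z) (form2 t w) = 2 * (1 + t' * t) * (z \<bullet> w)" for t' z w
    by (simp add: tensor_inner_2 \<omega>_contract)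
  have add: "tensor_inner 2 (S + T) \<gamma> = tensor_inner 2 S \<gamma> + tensor_inner 2 T \<gamma>" for S T \<gamma> :: "'a tensor"
    by (simp add: tensor_inner_2 algebra_simps sum.distrib)
  \<comment> \<open>The residual of a candidate \<open>form2 t z\<close> pairs to zero with all of
    the subspace only if \<open>x = z\<close>, as \<open>w = x - z\<close> shows; this gives
    uniqueness.\<close>
  have res: "tensor_inner 2 (form2 t x + form2 (- t) y - form2 t z) (form2 t w) = 4 * ((x - z) \<bullet> w)" for z w
  proof -
    have "form2 t x + form2 (- t) y - form2 t z = form2 t (x - z) + form2 (- t) y"
      by (simp flip: form2_linear)
    then show ?thesis by (simp only: add inner) (simp add: t)
  qed
  show ?thesis
    unfolding orth_proj_def Lambda2_sd_eq[OF t]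
  proof (rule the_equality)
    fix \<beta> assume "\<beta> \<in> range (form2 t) \<and>
      (\<forall>\<gamma>\<in>range (form2 t). tensor_inner 2 (form2 t x + form2 (- t) y - \<beta>) \<gamma> = 0)"
    then obtain z where z: "\<beta> = form2 t z" and "\<forall>w. (x - z) \<bullet> w = 0"
      using res by auto
    then have "x - z = 0" by (metis inner_eq_zero_iff)
    then show "\<beta> = form2 t x" using z by simp
  qed (auto simp: res inner t)
qed

lemma hat_curv_alt:
  assumes t: "t * t = 1" and A: "traceless_symmetric A"
  shows "hat (curv t A) (form2 t x + form2 (- t) y) = form2 t (- 2 *\<^sub>R (A *v x))"
  by (simp add: hat_add hat_curv_form2[OF t A])

text \<open>The composition kills the opposite duality and is multiplication by \<open>M\<close> on
  coordinates, so it is written through the coordinate functionals and the columns of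
  \<open>M\<close>.\<close>

lemma trace_on_hat_curv:
  assumes t: "t * t = 1" and A: "traceless_symmetric A" and B: "traceless_symmetric B"
  shows "trace_on (alt_tensors 2) (hat (curv t A) \<circ> hat (curv t B)) = 4 * trace (A ** B)"
proof -
  define S where "S = range (\<lambda>i. form2 t (axis i 1)) \<union> range (\<lambda>i. form2 (- t) (axis i 1))"
  have S: "form2 t' x \<in> span S" if "t' = t \<or> t' = - t" for t' x
  proof -
    have "form2 t' x = form2 t' (\<Sum>i\<in>UNIV. x $ i *\<^sub>R axis i 1)"
      by (simp add: basis_expansion flip: scalar_mult_eq_scaleR)
    also have "\<dots> = (\<Sum>i\<in>UNIV. x $ i *\<^sub>R form2 t' (axis i 1))"
      by (simp add: linear_sum[OF linear_form2] linear_scale[OF linear_form2])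
    also have "\<dots> \<in> span S"
      using that by (intro span_sum span_scale span_base) (auto simp: S_def)
    finally show ?thesis .
  qed
  \<comment> \<open>The 4 is the product of the factors -2 of the two actions.\<close>
  define M where "M = 4 *\<^sub>R (A ** B)"
  have "trace_on (alt_tensors 2) (hat (curv t A) \<circ> hat (curv t B))
      = (\<Sum>i\<in>UNIV. coord t (form2 t (column i M)) $ i)"
  proof (rule trace_on_finite_rank[OF subspace_alt_tensors_2, where \<phi> = "\<lambda>i \<alpha>. coord t \<alpha> $ i"
        and w = "\<lambda>i. form2 t (column i M)"])
    show "alt_tensors 2 \<subseteq> span S"
    proof
      fix \<alpha> :: "'a tensor" assume "\<alpha> \<in> alt_tensors 2"
      then show "\<alpha> \<in> span S"
        by (subst alt_tensors_2_decomp[OF t]) (auto intro: span_add S)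
    qed
    fix \<alpha> :: "'a tensor" assume \<alpha>: "\<alpha> \<in> alt_tensors 2"
    have "(hat (curv t A) \<circ> hat (curv t B)) \<alpha> = form2 t (M *v coord t \<alpha>)"
      by (subst alt_tensors_2_decomp[OF t \<alpha>])
        (simp add: hat_curv_alt[OF t] A B linear_neg[OF matrix_vector_mul_linear] hat_curv_form2 t M_def matrix_vector_mult_scaleR
          scaleR_matrix_vector_assoc[symmetric] matrix_vector_mul_assoc)
    also have "M *v coord t \<alpha> = (\<Sum>i\<in>UNIV. coord t \<alpha> $ i *\<^sub>R column i M)"
      by (simp add: matrix_mult_sum scalar_mult_eq_scaleR)
    finally show "(hat (curv t A) \<circ> hat (curv t B)) \<alpha>
        = (\<Sum>i\<in>UNIV. coord t \<alpha> $ i *\<^sub>R form2 t (column i M))"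
      by (simp add: linear_sum[OF linear_form2] linear_scale[OF linear_form2])
  qed (auto simp: S_def linear_coord form2_in_alt_tensors)
  then show ?thesis
    by (simp add: coord_form2 t column_def M_def trace_def sum_distrib_left)
qed

section \<open>The product formula and the spans of products\<close>

lemma hat_mult_formula:
  assumes t: "t * t = 1" and X: "X \<in> MCW_sd \<epsilon> t" and Y: "Y \<in> MCW_sd \<epsilon> t" and \<alpha>: "\<alpha> \<in> alt_tensors 2"
  shows "(1 / 3) *\<^sub>R hat (X \<ast> Y) \<alpha> =
     (1 / 2) *\<^sub>R ((hat X \<circ> hat Y) \<alpha> + (hat Y \<circ> hat X) \<alpha>)
     - ((1 / 3) * trace_on (alt_tensors 2) (hat X \<circ> hat Y)) *\<^sub>R orth_proj 2 (Lambda2_sd \<epsilon> t) \<alpha>"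
proof -
  obtain A B where X_eq: "X = curv t A" and Y_eq: "Y = curv t B"
    and A: "traceless_symmetric A" and B: "traceless_symmetric B"
    using X Y unfolding MCW_sd_eq[OF t] by blast
  obtain x y where \<alpha>_eq: "\<alpha> = form2 t x + form2 (- t) y"
    using alt_tensors_2_decomp[OF t \<alpha>] by blast
  note C = traceless_symmetric_jordan_prod[OF A B]
  \<comment> \<open>On coordinates the claim is -(2/3) J = 2 (A B + B A) - (4/3) tr(A B) I, where J
    is \<open>jordan_prod A B\<close>.\<close>
  show ?thesis
    unfolding X_eq Y_eq \<alpha>_eq o_apply curv_mult(1)[OF t A B] hat_curv_alt[OF t A] hat_curv_alt[OF t B]
      hat_curv_alt[OF t C] hat_curv_form2(1)[OF t A] hat_curv_form2(1)[OF t B] form2_linear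
      trace_on_hat_curv[OF t A B] orth_proj_Lambda2_sd[OF t]
    by (intro arg_cong[of _ _ "form2 t"])
      (simp add: jordan_prod_def matrix_vector_mult_diff_rdistrib matrix_vector_mult_add_rdistrib
        scaleR_matrix_vector_assoc[symmetric] matrix_vector_mul_assoc[symmetric] matrix_vector_mult_scaleR
        linear_neg[OF matrix_vector_mul_linear]
        algebra_simps)
qed

lemma mult_opposite:
  assumes t: "t * t = 1" and X: "X \<in> MCW_sd \<epsilon> t" and Y: "Y \<in> MCW_sd \<epsilon> (- t)"
  shows "X \<ast> Y = 0"
proof -
  have "(- t) * (- t) = 1" using t by simp
  then show ?thesis
    using X Y curv_mult(2)[OF t] unfolding MCW_sd_eq[OF t] MCW_sd_eq[OF \<open>(- t) * (- t) = 1\<close>] by blast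
qed

text \<open>Linearity of \<open>curv t\<close> moves the span to the matrices, where
  \<open>traceless_symmetric_span\<close> settles it.\<close>

lemma mult_span_MCW_sd:
  assumes t: "t * t = 1"
  shows "MCW_sd \<epsilon> t \<ast>\<^sub>S MCW_sd \<epsilon> t = MCW_sd \<epsilon> t"
proof -
  let ?J = "{jordan_prod M N | M N. traceless_symmetric M \<and> traceless_symmetric N}"
  have "{X \<ast> Y | X Y. X \<in> MCW_sd \<epsilon> t \<and> Y \<in> MCW_sd \<epsilon> t} = curv t ` ?J"
    unfolding MCW_sd_eq[OF t] using curv_mult(1)[OF t] by (auto simp: image_iff) metis+
  then have "MCW_sd \<epsilon> t \<ast>\<^sub>S MCW_sd \<epsilon> t = curv t ` span ?J"
    by (simp add: mc_mult_span_def linear_span_image[OF linear_curv])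
  also have "span ?J = {A. traceless_symmetric A}"
  proof (intro equalityI subsetI)
    have "subspace {A. traceless_symmetric A}"
      by (auto simp: subspace_def traceless_symmetric_iff right_diff_distrib)
    then show "A \<in> {A. traceless_symmetric A}" if "A \<in> span ?J" for A
      using span_minimal[of ?J "{A. traceless_symmetric A}"] traceless_symmetric_jordan_prod that by blast
  qed (use traceless_symmetric_span in blast)
  finally show ?thesis by (simp add: MCW_sd_eq[OF t])
qed

end

theorem lemma9p7:
  fixes \<epsilon> :: "'a::euclidean_space tensor"
  assumes dim: "DIM('a) = 4" and vol: "volume_form \<epsilon>"
  shows
    "(\<forall>\<sigma>\<in>{1, -1}. \<forall>X\<in>MCW_sd \<epsilon> \<sigma>. \<forall>Y\<in>MCW_sd \<epsilon> \<sigma>. \<forall>\<alpha>\<in>alt_tensors 2.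
        (1 / 3) *\<^sub>R hat (X \<ast> Y) \<alpha> =
          (1 / 2) *\<^sub>R ((hat X \<circ> hat Y) \<alpha> + (hat Y \<circ> hat X) \<alpha>)
          - ((1 / 3) * trace_on (alt_tensors 2) (hat X \<circ> hat Y)) *\<^sub>R orth_proj 2 (Lambda2_sd \<epsilon> \<sigma>) \<alpha>) \<and>
     (\<forall>X\<in>MCW_sd \<epsilon> 1. \<forall>Y\<in>MCW_sd \<epsilon> (-1). \<forall>\<alpha>\<in>alt_tensors 2. hat (X \<ast> Y) \<alpha> = 0) \<and>
     (\<forall>\<sigma>\<in>{1, -1}. MCW_sd \<epsilon> \<sigma> \<ast>\<^sub>S MCW_sd \<epsilon> \<sigma> = MCW_sd \<epsilon> \<sigma>) \<and>
     MCW_sd \<epsilon> 1 \<ast>\<^sub>S MCW_sd \<epsilon> (-1) = {0}"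
proof -
  obtain e0 e1 e2 e3 where "oriented_frame \<epsilon> e0 e1 e2 e3"
    using volume_form_frame[OF dim vol] .
  then interpret oriented_frame \<epsilon> e0 e1 e2 e3 .
  have sq: "\<sigma> * \<sigma> = 1" if "\<sigma> \<in> {1, -1}" for \<sigma> :: real
    using that by auto
  have zero: "X \<ast> Y = 0" if "X \<in> MCW_sd \<epsilon> 1" "Y \<in> MCW_sd \<epsilon> (-1)" for X Y
    using mult_opposite[of 1 X Y] that by simp
  have "hat (X \<ast> Y) \<alpha> = 0" if "X \<in> MCW_sd \<epsilon> 1" "Y \<in> MCW_sd \<epsilon> (-1)" for X Y \<alpha>
    by (simp add: zero[OF that] hat_def fun_eq_iff case_prod_beta)
  moreover have "MCW_sd \<epsilon> 1 \<ast>\<^sub>S MCW_sd \<epsilon> (-1) = {0}"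
  proof -
    have "{X \<ast> Y | X Y. X \<in> MCW_sd \<epsilon> 1 \<and> Y \<in> MCW_sd \<epsilon> (-1)} \<subseteq> {0}"
      using zero by blast
    then have "MCW_sd \<epsilon> 1 \<ast>\<^sub>S MCW_sd \<epsilon> (-1) \<subseteq> span {0}"
      unfolding mc_mult_span_def by (rule span_mono)
    then show ?thesis
      using span_zero[of "{X \<ast> Y | X Y. X \<in> MCW_sd \<epsilon> 1 \<and> Y \<in> MCW_sd \<epsilon> (-1)}"]
      by (auto simp: mc_mult_span_def)
  qed
  ultimately show ?thesis
    by (intro conjI ballI hat_mult_formula mult_span_MCW_sd sq)
qed

end
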